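(* Let $(M,[g])$ be a conformal manifold of dimension $n\geq 3$, let $s\in\Gamma(\mathcal A)$ be a parallel section of the adjoint tractor bundle with underlying conformal Killing field $\mathbf k$, and suppose that $\mathbf k$ is isotropic, i.e. $\mathbf k^a\mathbf k_a=0$. Then for any metric in the conformal class, with Levi-Civita connection $\nabla$ and Schouten tensor $\mathsf P$, the function $$\tfrac{1}{n^2}(\nabla_a\mathbf k^a)^2-\mathbf k^a\mathsf P_{ab}\mathbf k^b-\tfrac1n\mathbf k^a\nabla_a\nabla_b\mathbf k^b$$ is equal to some constant $\lambda\in\mathbb R$. This constant is independent of the choice of metric from the conformal class, and $s\circ s=\lambda\,\mathrm{id}\in\Gamma(\mathrm{End}(\mathcal T))$.
   Context: Let $(M,[g])$ be a conformal manifold of dimension $n\ge 3$ and signature $(p,q)$, $\mathcal E[w]$ the density bundle of conformal weight $w$ (with $\mathcal E[-n]$ the bundle of volume densities), $\mathbf g_{ab}\in\Gamma(\mathcal E_{(ab)}[2])$ the conformal metric, used to raise and lower indices. For $g\in[g]$ with Levi-Civita connection $\nabla$, the Schouten tensor is $\mathsf P_{ab}=\frac{1}{n-2}\big(\mathrm{Ric}_{ab}-\frac{\mathrm{Sc}}{2(n-1)}g_{ab}\big)$. The choice of $g$ identifies the standard tractor bundle $\mathcal T$ with $\mathcal E[1]\oplus\mathcal E_a[1]\oplus\mathcal E[-1]$; for $\hat g=e^{2f}g$, $\Upsilon=df$, one has $\widehat{(\sigma,\mu_a,\rho)}=(\sigma,\mu_a+\sigma\Upsilon_a,\rho-\Upsilon^b\mu_b-\frac12\Upsilon^b\Upsilon_b\sigma)$.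 The tractor metric $h$, of signature $(p+1,q+1)$, is given by the quadratic form $2\sigma\rho+\mu^a\mu_a$; $\mathcal T^1=\{(0,0,\rho)\}$; and the tractor connection is $\nabla^{\mathcal T}_a(\sigma,\mu_b,\rho)=(\nabla_a\sigma-\mu_a,\ \nabla_a\mu_b+\mathbf g_{ab}\rho+\mathsf P_{ab}\sigma,\ \nabla_a\rho-\mathsf P_{ab}\mu^b)$. The adjoint tractor bundle is $\mathcal A=\mathfrak{so}(\mathcal T)$, the bundle of $h$-skew-symmetric endomorphisms of $\mathcal T$, with the connection $\nabla^{\mathcal A}$ induced by $\nabla^{\mathcal T}$; ``parallel'' means parallel for $\nabla^{\mathcal A}$. The canonical projection $\Pi:\mathcal A\to TM$ sends $s$ to the vector $\mathbf k^a$ determined by $s(0,0,\rho)=(0,-\rho\,\mathbf k_a,* )$ for $\rho\in\mathcal E[-1]$; $\mathbf k=\Pi(s)$ is the vector field underlying $s$. If $s$ is parallel, then $\mathbf k$ is a conformal Killing field.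
   Formalization: The manifold M is assumed connected; without this the function is only locally constant, e.g. on two copies of flat R^{2,2} with s∘s=id on one and s=0 on the other, so no single λ exists. *)

theory Defs
  imports "HOL-Analysis.Analysis"
begin

section \<open>Smooth manifolds\<close>

text \<open>
  A manifold of dimension \<open>n = CARD('n)\<close> is a second countable Hausdorff type \<open>'m\<close> with a smooth
  atlas.  A chart is a pair of its domain and its coordinate map; the values of the map outside
  the domain are irrelevant.  Sections of natural bundles are given by their components in the
  charts of the atlas, related by the transition functions of the bundle.  All components are
  functions of the point of the manifold (not of its coordinates).
\<close>

primrec C_k_on :: "nat \<Rightarrow> (real^'n) set \<Rightarrow> (real^'n \<Rightarrow> 'b::real_normed_vector) \<Rightarrow> bool" where
  "C_k_on 0 U f \<longleftrightarrow> continuous_on U f"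
| "C_k_on (Suc k) U f \<longleftrightarrow> (\<forall>y\<in>U. f differentiable (at y)) \<and>
     (\<forall>i. C_k_on k U (\<lambda>y. frechet_derivative f (at y) (axis i 1)))"

definition smooth_on :: "(real^'n) set \<Rightarrow> (real^'n \<Rightarrow> 'b::real_normed_vector) \<Rightarrow> bool" where
  "smooth_on U f \<longleftrightarrow> (\<forall>k. C_k_on k U f)"

type_synonym ('m, 'n) chart = "'m set \<times> ('m \<Rightarrow> real^'n)"

abbreviation dom_ch :: "('m, 'n) chart \<Rightarrow> 'm set" where "dom_ch c \<equiv> fst c"
abbreviation map_ch :: "('m, 'n) chart \<Rightarrow> 'm \<Rightarrow> real^'n" where "map_ch c \<equiv> snd c"

definition inv_ch :: "('m, 'n) chart \<Rightarrow> real^'n \<Rightarrow> 'm" where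
  "inv_ch c = inv_into (dom_ch c) (map_ch c)"

definition smooth_atlas ::
    "('m::{t2_space, second_countable_topology}, 'n::finite) chart set \<Rightarrow> bool" where
  "smooth_atlas A \<longleftrightarrow>
     (\<Union>c\<in>A. dom_ch c) = UNIV \<and>
     (\<forall>c\<in>A. open (dom_ch c) \<and> open (map_ch c ` dom_ch c) \<and>
        homeomorphism (dom_ch c) (map_ch c ` dom_ch c) (map_ch c) (inv_ch c)) \<and>
     (\<forall>c\<in>A. \<forall>d\<in>A. smooth_on (map_ch c ` (dom_ch c \<inter> dom_ch d)) (map_ch d \<circ> inv_ch c))"

definition smooth_in :: "('m, 'n::finite) chart \<Rightarrow> ('m \<Rightarrow> 'b::real_normed_vector) \<Rightarrow> bool" where
  "smooth_in c f \<longleftrightarrow> smooth_on (map_ch c ` dom_ch c) (f \<circ> inv_ch c)"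

definition pd :: "('m, 'n::finite) chart \<Rightarrow> 'n \<Rightarrow> ('m \<Rightarrow> 'b::real_normed_vector) \<Rightarrow> 'm \<Rightarrow> 'b" where
  "pd c a f x = frechet_derivative (f \<circ> inv_ch c) (at (map_ch c x)) (axis a 1)"

text \<open>\<open>jac c d x $ i $ j\<close> is the derivative of the \<open>i\<close>-th coordinate of \<open>d\<close> by the \<open>j\<close>-th of \<open>c\<close>.\<close>

definition jac :: "('m, 'n::finite) chart \<Rightarrow> ('m, 'n) chart \<Rightarrow> 'm \<Rightarrow> real^'n^'n" where
  "jac c d x = jacobian (map_ch d \<circ> inv_ch c) (at (map_ch c x))"

definition vector_field ::
    "('m, 'n::finite) chart set \<Rightarrow> (('m, 'n) chart \<Rightarrow> 'm \<Rightarrow> real^'n) \<Rightarrow> bool" where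
  "vector_field A X \<longleftrightarrow>
     (\<forall>c\<in>A. smooth_in c (X c)) \<and>
     (\<forall>c\<in>A. \<forall>d\<in>A. \<forall>x\<in>dom_ch c \<inter> dom_ch d. X d x = jac c d x *v X c x)"


section \<open>Conformal structures\<close>

type_synonym ('m, 'n) metric_field = "('m, 'n) chart \<Rightarrow> 'm \<Rightarrow> real^'n^'n"

definition signature :: "real^'n^'n \<Rightarrow> nat \<Rightarrow> nat \<Rightarrow> bool" where
  "signature G p q \<longleftrightarrow> p + q = CARD('n) \<and>
     (\<exists>V W. subspace V \<and> subspace W \<and> dim V = p \<and> dim W = q \<and>
        (\<forall>v\<in>V. v \<noteq> 0 \<longrightarrow> v \<bullet> (G *v v) > 0) \<and>
        (\<forall>w\<in>W. w \<noteq> 0 \<longrightarrow> w \<bullet> (G *v w) < 0))"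

definition pseudo_metric ::
    "('m, 'n::finite) chart set \<Rightarrow> nat \<Rightarrow> nat \<Rightarrow> ('m, 'n) metric_field \<Rightarrow> bool" where
  "pseudo_metric A p q g \<longleftrightarrow>
     (\<forall>c\<in>A. smooth_in c (g c)) \<and>
     (\<forall>c\<in>A. \<forall>x\<in>dom_ch c.
        transpose (g c x) = g c x \<and> invertible (g c x) \<and> signature (g c x) p q) \<and>
     (\<forall>c\<in>A. \<forall>d\<in>A. \<forall>x\<in>dom_ch c \<inter> dom_ch d.
        g c x = transpose (jac c d x) ** g d x ** jac c d x)"

text \<open>\<open>rescaling A g h f\<close> means \<open>h = e\<^sup>2\<^sup>f g\<close>.\<close>

definition rescaling ::
    "('m, 'n::finite) chart set \<Rightarrow> ('m, 'n) metric_field \<Rightarrow> ('m, 'n) metric_field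
      \<Rightarrow> ('m \<Rightarrow> real) \<Rightarrow> bool" where
  "rescaling A g h f \<longleftrightarrow>
     (\<forall>c\<in>A. smooth_in c f) \<and> (\<forall>c\<in>A. \<forall>x\<in>dom_ch c. h c x = exp (2 * f x) *\<^sub>R g c x)"

definition conformal_class ::
    "('m, 'n::finite) chart set \<Rightarrow> nat \<Rightarrow> nat \<Rightarrow> ('m, 'n) metric_field set \<Rightarrow> bool" where
  "conformal_class A p q C \<longleftrightarrow>
     (\<exists>g. pseudo_metric A p q g \<and> C = {h. pseudo_metric A p q h \<and> (\<exists>f. rescaling A g h f)})"

text \<open>
  Densities of weight \<open>w\<close> have one component \<open>\<sigma>\<close> in each chart, and the components in charts \<open>c\<close>
  and \<open>d\<close> are related by \<open>\<sigma>\<^sub>d = \<bar>det (jac c d)\<bar>\<^bsup>w/n\<^esup> \<sigma>\<^sub>c\<close>; weight \<open>-n\<close> gives the volume densities.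
  The conformal metric has weight \<open>2\<close> and does not depend on the choice of \<open>g\<close> in the class.
\<close>

definition wt :: "real \<Rightarrow> ('m, 'n::finite) chart \<Rightarrow> ('m, 'n) chart \<Rightarrow> 'm \<Rightarrow> real" where
  "wt w c d x = \<bar>det (jac c d x)\<bar> powr (w / real CARD('n))"

definition conf_metric :: "('m, 'n::finite) chart \<Rightarrow> ('m, 'n) metric_field \<Rightarrow> 'm \<Rightarrow> real^'n^'n" where
  "conf_metric c g x = (\<bar>det (g c x)\<bar> powr (- 1 / real CARD('n))) *\<^sub>R g c x"


section \<open>Levi-Civita connection and Schouten tensor\<close>

text \<open>\<open>christoffel c g e a b x\<close> is \<open>\<Gamma>\<^sup>e\<^sub>a\<^sub>b\<close>.\<close>

definition christoffel ::
    "('m, 'n::finite) chart \<Rightarrow> ('m, 'n) metric_field \<Rightarrow> 'n \<Rightarrow> 'n \<Rightarrow> 'n \<Rightarrow> 'm \<Rightarrow> real" where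
  "christoffel c g e a b x = (1/2) * (\<Sum>d\<in>UNIV. matrix_inv (g c x) $ e $ d *
     (pd c a (\<lambda>y. g c y $ b $ d) x + pd c b (\<lambda>y. g c y $ a $ d) x - pd c d (\<lambda>y. g c y $ a $ b) x))"

definition nabla_vec ::
    "('m, 'n::finite) chart \<Rightarrow> ('m, 'n) metric_field \<Rightarrow> 'n \<Rightarrow> ('m \<Rightarrow> real^'n) \<Rightarrow> 'm \<Rightarrow> real^'n" where
  "nabla_vec c g a X x =
     (\<chi> b. pd c a (\<lambda>y. X y $ b) x + (\<Sum>e\<in>UNIV. christoffel c g b a e x * X x $ e))"

definition divergence ::
    "('m, 'n::finite) chart \<Rightarrow> ('m, 'n) metric_field \<Rightarrow> ('m \<Rightarrow> real^'n) \<Rightarrow> 'm \<Rightarrow> real" where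
  "divergence c g X x = (\<Sum>a\<in>UNIV. nabla_vec c g a X x $ a)"

text \<open>The connections induced on densities and on weighted covectors.  On volume densities
  (\<open>w = -n\<close>) the induced connection is \<open>\<partial>\<^sub>a\<nu> - \<Gamma>\<^sup>b\<^sub>a\<^sub>b \<nu>\<close>.\<close>

definition nabla_dens ::
    "real \<Rightarrow> ('m, 'n::finite) chart \<Rightarrow> ('m, 'n) metric_field \<Rightarrow> 'n \<Rightarrow> ('m \<Rightarrow> real) \<Rightarrow> 'm \<Rightarrow> real" where
  "nabla_dens w c g a \<sigma> x =
     pd c a \<sigma> x + w / real CARD('n) * (\<Sum>b\<in>UNIV. christoffel c g b a b x) * \<sigma> x"

definition nabla_covec ::
    "real \<Rightarrow> ('m, 'n::finite) chart \<Rightarrow> ('m, 'n) metric_field \<Rightarrow> 'n \<Rightarrow> ('m \<Rightarrow> real^'n)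
      \<Rightarrow> 'm \<Rightarrow> real^'n" where
  "nabla_covec w c g a \<mu> x =
     (\<chi> b. nabla_dens w c g a (\<lambda>y. \<mu> y $ b) x - (\<Sum>e\<in>UNIV. christoffel c g e a b x * \<mu> x $ e))"

text \<open>\<open>riemann c g a b e d x\<close> is the \<open>e\<close>-component of \<open>R(\<partial>\<^sub>a, \<partial>\<^sub>b) \<partial>\<^sub>d\<close>, where
  \<open>R(X, Y) = [\<nabla>\<^sub>X, \<nabla>\<^sub>Y] - \<nabla>\<^bsub>[X, Y]\<^esub>\<close>; its trace over \<open>a\<close> and \<open>e\<close> is positive on spheres.\<close>

definition riemann ::
    "('m, 'n::finite) chart \<Rightarrow> ('m, 'n) metric_field \<Rightarrow> 'n \<Rightarrow> 'n \<Rightarrow> 'n \<Rightarrow> 'n \<Rightarrow> 'm \<Rightarrow> real" where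
  "riemann c g a b e d x =
     pd c a (christoffel c g e b d) x - pd c b (christoffel c g e a d) x
     + (\<Sum>f\<in>UNIV. christoffel c g e a f x * christoffel c g f b d x
                - christoffel c g e b f x * christoffel c g f a d x)"

definition ricci :: "('m, 'n::finite) chart \<Rightarrow> ('m, 'n) metric_field \<Rightarrow> 'm \<Rightarrow> real^'n^'n" where
  "ricci c g x = (\<chi> b d. \<Sum>a\<in>UNIV. riemann c g a b a d x)"

definition scal :: "('m, 'n::finite) chart \<Rightarrow> ('m, 'n) metric_field \<Rightarrow> 'm \<Rightarrow> real" where
  "scal c g x = (\<Sum>a\<in>UNIV. \<Sum>b\<in>UNIV. matrix_inv (g c x) $ a $ b * ricci c g x $ a $ b)"

definition schouten :: "('m, 'n::finite) chart \<Rightarrow> ('m, 'n) metric_field \<Rightarrow> 'm \<Rightarrow> real^'n^'n" where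
  "schouten c g x = (1 / (real CARD('n) - 2)) *\<^sub>R
     (ricci c g x - (scal c g x / (2 * (real CARD('n) - 1))) *\<^sub>R g c x)"

lemma pd_cong:
  assumes "smooth_atlas A" "c \<in> A" "x \<in> dom_ch c" "\<And>y. y \<in> dom_ch c \<Longrightarrow> f y = h y"
  shows "pd c a f x = pd c a h x"
proof -
  let ?U = "map_ch c ` dom_ch c"
  have o: "open ?U" and xU: "map_ch c x \<in> ?U" using assms by (auto simp: smooth_atlas_def)
  have eq: "(f \<circ> inv_ch c) y = (h \<circ> inv_ch c) y" if "y \<in> ?U" for y
    using assms(4) inv_into_into[OF that] by (simp add: inv_ch_def)
  have "((f \<circ> inv_ch c) has_derivative D) (at (map_ch c x)) \<longleftrightarrow>
        ((h \<circ> inv_ch c) has_derivative D) (at (map_ch c x))" for D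
    by (rule iffI; erule has_derivative_transform_within_open[OF _ o xU]) (simp_all only: eq)
  then show ?thesis by (simp add: pd_def frechet_derivative_def)
qed

text \<open>The Christoffel symbols are those of the unique torsion-free connection with \<open>\<nabla>g = 0\<close>.\<close>

lemma christoffel_iff:
  fixes A :: "('m::{t2_space, second_countable_topology}, 'n::finite) chart set"
  assumes A: "smooth_atlas A" and g: "pseudo_metric A p q g" and c: "c \<in> A" and x: "x \<in> dom_ch c"
  shows "(\<forall>e a b. \<Gamma> e a b = \<Gamma> e b a) \<and>
     (\<forall>a b d. pd c a (\<lambda>y. g c y $ b $ d) x
        = (\<Sum>e\<in>UNIV. \<Gamma> e a b * g c x $ e $ d) + (\<Sum>e\<in>UNIV. \<Gamma> e a d * g c x $ b $ e))
     \<longleftrightarrow> (\<forall>e a b. \<Gamma> e a b = christoffel c g e a b x)"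
proof -
  define G where "G = g c x"
  define D where "D a b d = pd c a (\<lambda>y. g c y $ b $ d) x" for a b d
  define L where "L \<Gamma> a b d = (\<Sum>e\<in>UNIV. G $ d $ e * \<Gamma> e a b)" for \<Gamma> :: "'n \<Rightarrow> 'n \<Rightarrow> 'n \<Rightarrow> real" and a b d
  have tr: "transpose (g c y) = g c y" if "y \<in> dom_ch c" for y
    using g c that unfolding pseudo_metric_def by blast
  have sym: "g c y $ a $ b = g c y $ b $ a" if "y \<in> dom_ch c" for y a b
    using arg_cong[OF tr[OF that], of "\<lambda>M. M $ b $ a"] by (simp add: transpose_def)
  have Dsym: "D a b d = D a d b" for a b d
    unfolding D_def by (rule pd_cong[OF A c x]) (rule sym)
  have inv: "invertible G" using g c x unfolding pseudo_metric_def G_def by blast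
  have mi: "G ** matrix_inv G = mat 1 \<and> matrix_inv G ** G = mat 1"
    using someI_ex[OF inv[unfolded invertible_def]] by (simp only: matrix_inv_def)
  have "(matrix_inv G ** G) $ i $ j = mat 1 $ i $ j" "(G ** matrix_inv G) $ i $ j = mat 1 $ i $ j" for i j
    using mi by simp_all
  then have GiG: "(\<Sum>d\<in>UNIV. matrix_inv G $ i $ d * G $ d $ j) = (if i = j then 1 else 0)"
    and GGi: "(\<Sum>d\<in>UNIV. G $ i $ d * matrix_inv G $ d $ j) = (if i = j then 1 else 0)" for i j
    by (simp_all add: matrix_matrix_mult_def mat_def)
  have Gsym: "G $ a $ b = G $ b $ a" for a b using sym[OF x] by (simp add: G_def)
  have recover: "(\<Sum>d\<in>UNIV. matrix_inv G $ f $ d * L \<Gamma> a b d) = \<Gamma> f a b" for \<Gamma> f a b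
  proof -
    have "(\<Sum>d\<in>UNIV. matrix_inv G $ f $ d * L \<Gamma> a b d)
        = (\<Sum>d\<in>UNIV. \<Sum>e\<in>UNIV. \<Gamma> e a b * (matrix_inv G $ f $ d * G $ d $ e))"
      unfolding L_def sum_distrib_left by (intro sum.cong refl) (simp only: mult_ac)
    also have "\<dots> = (\<Sum>e\<in>UNIV. \<Gamma> e a b * (\<Sum>d\<in>UNIV. matrix_inv G $ f $ d * G $ d $ e))"
      by (subst sum.swap) (simp only: sum_distrib_left)
    also have "\<dots> = \<Gamma> f a b" by (simp add: GiG if_distrib[of "\<lambda>z. _ * z"] cong: if_cong)
    finally show ?thesis .
  qed
  have chr: "christoffel c g e a b x =
      (\<Sum>d\<in>UNIV. matrix_inv G $ e $ d * ((1/2) * (D a b d + D b a d - D d a b)))" for e a b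
    unfolding christoffel_def G_def D_def sum_distrib_left by (intro sum.cong refl) simp
  have Lchr: "L (\<lambda>e a b. christoffel c g e a b x) a b d
      = (1/2) * (D a b d + D b a d - D d a b)" for a b d
  proof -
    have "L (\<lambda>e a b. christoffel c g e a b x) a b d = (\<Sum>e\<in>UNIV. \<Sum>f\<in>UNIV.
        (G $ d $ e * matrix_inv G $ e $ f) * ((1/2) * (D a b f + D b a f - D f a b)))"
      unfolding L_def chr sum_distrib_left by (intro sum.cong refl) (simp only: mult_ac)
    also have "\<dots> = (\<Sum>f\<in>UNIV. (\<Sum>e\<in>UNIV. G $ d $ e * matrix_inv G $ e $ f)
        * ((1/2) * (D a b f + D b a f - D f a b)))"
      by (subst sum.swap) (simp only: sum_distrib_right)
    also have "\<dots> = (\<Sum>f\<in>UNIV. if d = f then (1/2) * (D a b f + D b a f - D f a b) else 0)"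
      by (intro sum.cong refl) (simp add: GGi)
    finally show ?thesis by simp
  qed
  have metr: "(\<Sum>e\<in>UNIV. \<Gamma> e a b * g c x $ e $ d) + (\<Sum>e\<in>UNIV. \<Gamma> e a d * g c x $ b $ e)
      = L \<Gamma> a b d + L \<Gamma> a d b" for \<Gamma> a b d
    unfolding L_def G_def[symmetric] using Gsym by (simp add: mult.commute)
  show ?thesis
    unfolding metr D_def[symmetric]
  proof (intro iffI conjI)
    assume H: "(\<forall>e a b. \<Gamma> e a b = \<Gamma> e b a) \<and> (\<forall>a b d. D a b d = L \<Gamma> a b d + L \<Gamma> a d b)"
    from H have S: "\<Gamma> e a b = \<Gamma> e b a" and M: "D a b d = L \<Gamma> a b d + L \<Gamma> a d b" for e a b d
      by blast+
    have LS: "L \<Gamma> a b d = L \<Gamma> b a d" for a b d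
      unfolding L_def by (intro sum.cong refl) (metis S)
    have "(1/2) * (D a b d + D b a d - D d a b) = L \<Gamma> a b d" for a b d
      unfolding M LS[of b a d] LS[of d a b] LS[of d b a] by simp
    then show "\<forall>e a b. \<Gamma> e a b = christoffel c g e a b x" by (simp only: chr recover simp_thms)
  next
    assume H: "\<forall>e a b. \<Gamma> e a b = christoffel c g e a b x"
    then have \<Gamma>: "\<Gamma> = (\<lambda>e a b. christoffel c g e a b x)" by (intro ext) blast
    show "\<forall>e a b. \<Gamma> e a b = \<Gamma> e b a"
      unfolding \<Gamma> chr using Dsym by (simp add: add.commute)
    show "\<forall>a b d. D a b d = L \<Gamma> a b d + L \<Gamma> a d b"
      unfolding \<Gamma> Lchr by (simp add: field_simps Dsym)
  qed
qed


section \<open>Tractors\<close>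

text \<open>A tractor is given, in each chart and each metric of the class, by its components
  \<open>(\<sigma>, \<mu>, \<rho>)\<close>.\<close>

type_synonym 'n tractor = "real \<times> (real^'n) \<times> real"

text \<open>From components in \<open>c\<close> to components in \<open>d\<close>; note that the inverse of \<open>jac c d x\<close> is
  \<open>jac d c x\<close>.\<close>

definition chart_change ::
    "('m, 'n::finite) chart \<Rightarrow> ('m, 'n) chart \<Rightarrow> 'm \<Rightarrow> 'n tractor \<Rightarrow> 'n tractor" where
  "chart_change c d x = (\<lambda>(\<sigma>, \<mu>, \<rho>).
     (wt 1 c d x * \<sigma>, wt 1 c d x *\<^sub>R (transpose (jac d c x) *v \<mu>), wt (-1) c d x * \<rho>))"

text \<open>From components in the metric \<open>g\<close> to components in \<open>e\<^sup>2\<^sup>f g\<close>.\<close>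

definition scale_change ::
    "('m, 'n::finite) chart \<Rightarrow> ('m, 'n) metric_field \<Rightarrow> ('m \<Rightarrow> real) \<Rightarrow> 'm
      \<Rightarrow> 'n tractor \<Rightarrow> 'n tractor" where
  "scale_change c g f x = (\<lambda>(\<sigma>, \<mu>, \<rho>).
     let \<Upsilon> = (\<chi> a. pd c a f x); \<Upsilon>' = matrix_inv (conf_metric c g x) *v \<Upsilon>
     in (\<sigma>, \<mu> + \<sigma> *\<^sub>R \<Upsilon>, \<rho> - \<Upsilon>' \<bullet> \<mu> - (1/2) * (\<Upsilon>' \<bullet> \<Upsilon>) * \<sigma>))"

definition tractor_metric ::
    "('m, 'n::finite) chart \<Rightarrow> ('m, 'n) metric_field \<Rightarrow> 'm \<Rightarrow> 'n tractor \<Rightarrow> 'n tractor \<Rightarrow> real" where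
  "tractor_metric c g x = (\<lambda>(\<sigma>, \<mu>, \<rho>) (\<sigma>', \<mu>', \<rho>').
     \<sigma> * \<rho>' + \<rho> * \<sigma>' + \<mu> \<bullet> (matrix_inv (conf_metric c g x) *v \<mu>'))"

definition nabla_tractor ::
    "('m, 'n::finite) chart \<Rightarrow> ('m, 'n) metric_field \<Rightarrow> 'n \<Rightarrow> ('m \<Rightarrow> 'n tractor)
      \<Rightarrow> 'm \<Rightarrow> 'n tractor" where
  "nabla_tractor c g a t x =
     (let \<sigma> = (\<lambda>y. fst (t y)); \<mu> = (\<lambda>y. fst (snd (t y))); \<rho> = (\<lambda>y. snd (snd (t y)))
      in (nabla_dens 1 c g a \<sigma> x - \<mu> x $ a,
          nabla_covec 1 c g a \<mu> x + \<rho> x *\<^sub>R (conf_metric c g x $ a) + \<sigma> x *\<^sub>R (schouten c g x $ a),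
          nabla_dens (-1) c g a \<rho> x
            - (schouten c g x $ a) \<bullet> (matrix_inv (conf_metric c g x) *v \<mu> x)))"

text \<open>Smooth sections of \<open>\<A> = \<ss>\<oo>(\<T>)\<close>.\<close>

type_synonym ('m, 'n) tractor_endo =
  "('m, 'n) chart \<Rightarrow> ('m, 'n) metric_field \<Rightarrow> 'm \<Rightarrow> 'n tractor \<Rightarrow> 'n tractor"

definition adjoint_tractor_field ::
    "('m, 'n::finite) chart set \<Rightarrow> ('m, 'n) metric_field set \<Rightarrow> ('m, 'n) tractor_endo \<Rightarrow> bool" where
  "adjoint_tractor_field A C s \<longleftrightarrow>
     (\<forall>c\<in>A. \<forall>g\<in>C. \<forall>v. smooth_in c (\<lambda>x. s c g x v)) \<and>
     (\<forall>c\<in>A. \<forall>g\<in>C. \<forall>x\<in>dom_ch c. linear (s c g x) \<and>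
        (\<forall>v w. tractor_metric c g x (s c g x v) w + tractor_metric c g x v (s c g x w) = 0)) \<and>
     (\<forall>c\<in>A. \<forall>d\<in>A. \<forall>g\<in>C. \<forall>x\<in>dom_ch c \<inter> dom_ch d. \<forall>v.
        s d g x (chart_change c d x v) = chart_change c d x (s c g x v)) \<and>
     (\<forall>c\<in>A. \<forall>g\<in>C. \<forall>h\<in>C. \<forall>f. rescaling A g h f \<longrightarrow> (\<forall>x\<in>dom_ch c. \<forall>v.
        s c h x (scale_change c g f x v) = scale_change c g f x (s c g x v)))"

text \<open>The induced connection: \<open>nabla_adjoint c g a S t x\<close> is \<open>(\<nabla>\<^sub>a S) t = \<nabla>\<^sub>a (S t) - S (\<nabla>\<^sub>a t)\<close>.\<close>

definition nabla_adjoint ::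
    "('m, 'n::finite) chart \<Rightarrow> ('m, 'n) metric_field \<Rightarrow> 'n \<Rightarrow> ('m \<Rightarrow> 'n tractor \<Rightarrow> 'n tractor)
      \<Rightarrow> ('m \<Rightarrow> 'n tractor) \<Rightarrow> 'm \<Rightarrow> 'n tractor" where
  "nabla_adjoint c g a S t x =
     nabla_tractor c g a (\<lambda>y. S y (t y)) x - S x (nabla_tractor c g a t x)"

definition parallel_adjoint ::
    "('m, 'n::finite) chart set \<Rightarrow> ('m, 'n) metric_field set \<Rightarrow> ('m, 'n) tractor_endo \<Rightarrow> bool" where
  "parallel_adjoint A C s \<longleftrightarrow>
     (\<forall>c\<in>A. \<forall>g\<in>C. \<forall>t. smooth_in c t \<longrightarrow>
        (\<forall>a. \<forall>x\<in>dom_ch c. nabla_adjoint c g a (s c g) t x = 0))"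

text \<open>\<open>k = \<Pi>(s)\<close>\<close>

definition underlying_field ::
    "('m, 'n::finite) chart set \<Rightarrow> ('m, 'n) metric_field set \<Rightarrow> ('m, 'n) tractor_endo
      \<Rightarrow> (('m, 'n) chart \<Rightarrow> 'm \<Rightarrow> real^'n) \<Rightarrow> bool" where
  "underlying_field A C s k \<longleftrightarrow> vector_field A k \<and>
     (\<forall>c\<in>A. \<forall>g\<in>C. \<forall>x\<in>dom_ch c. \<forall>\<rho>. \<exists>r.
        s c g x (0, 0, \<rho>) = (0, (- \<rho>) *\<^sub>R (conf_metric c g x *v k c x), r))"

definition isotropic_field ::
    "('m, 'n::finite) chart set \<Rightarrow> ('m, 'n) metric_field set
      \<Rightarrow> (('m, 'n) chart \<Rightarrow> 'm \<Rightarrow> real^'n) \<Rightarrow> bool" where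
  "isotropic_field A C k \<longleftrightarrow>
     (\<forall>c\<in>A. \<forall>g\<in>C. \<forall>x\<in>dom_ch c. k c x \<bullet> (conf_metric c g x *v k c x) = 0)"

end

theory Submission
  imports Defs
begin

text \<open>
  Write \<open>X = (0,0,1)\<close>, \<open>Y = (1,0,0)\<close>.  As \<open>h (s X) (s X) = k\<^sup>ak\<^sub>a = 0\<close>, differentiating once shows
  \<open>s (s X) = \<lambda> X\<close> for a function \<open>\<lambda>\<close>.  Since \<open>s \<circ> s\<close> is parallel and \<open>h\<close>-symmetric, one more
  derivative gives \<open>s (s Z) = \<lambda> Z + \<nu>(Z) X\<close> on the middle slot, where \<open>\<nu> = d\<lambda>\<close> up to raising the
  index.  Differentiating this again yields \<open>- \<delta>\<^sup>a\<^sub>b \<lambda>\<^sub>d = \<delta>\<^sup>a\<^sub>d \<lambda>\<^sub>b + \<nu>\<^sup>a g\<^sub>b\<^sub>d\<close> with \<open>\<lambda>\<^sub>d = \<nabla>\<^sub>d\<lambda>\<close>,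
  whose trace over \<open>a, b\<close> is \<open>(n + 2) d\<lambda> = 0\<close>; hence \<open>s \<circ> s = \<lambda> id\<close> with \<open>\<lambda>\<close> constant.  Finally
  \<open>s X = (0, -k\<^sub>a, r)\<close> with \<open>n r = \<nabla>\<^sub>ak\<^sup>a\<close>, and the bottom slot of \<open>s (s X)\<close> is the stated expression.
\<close>

section \<open>Derivatives in a chart\<close>

lemma has_derivative_det_mat_1:
  "(det has_derivative trace) (at (mat 1 :: real^'n^'n))"
proof -
  let ?D = "\<lambda>H :: real^'n^'n. \<Sum>p | p permutes (UNIV::'n set). of_int (sign p) *
    (\<Sum>i\<in>UNIV. H$i$p i * (\<Prod>j\<in>UNIV-{i}. (mat 1 :: real^'n^'n)$j$p j))"
  have "(det has_derivative ?D) (at (mat 1))"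
    unfolding det_def
    by (intro has_derivative_sum has_derivative_mult_right has_derivative_prod)
       (rule bounded_linear_imp_has_derivative,
        rule bounded_linear_compose[OF bounded_linear_vec_nth bounded_linear_vec_nth])
  moreover have "?D = trace"
  proof
    fix H :: "real^'n^'n"
    \<comment> \<open>In the Leibniz formula at the identity matrix, the factors other than
      \<open>i\<close> vanish unless \<open>p\<close> fixes every \<open>j \<noteq> i\<close>; a
      permutation that fixes all but one index fixes that one too.\<close>
    have z: "(\<Prod>j\<in>UNIV-{i}. (mat 1 :: real^'n^'n)$j$p j) = (if p = id then 1 else 0)"
      if "p permutes UNIV" for p and i :: 'n
    proof (cases "p = id")
      case False
      have "\<exists>j. j \<noteq> i \<and> p j \<noteq> j"
      proof (rule ccontr)
        assume "\<not> ?thesis"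
        then have fix_p: "p j = j" if "j \<noteq> i" for j using that by blast
        moreover have "p i = i"
          using fix_p permutes_inj[OF \<open>p permutes UNIV\<close>] by (metis injD)
        ultimately have "p = id" by (metis eq_id_iff)
        with False show False ..
      qed
      then show ?thesis using False by (auto simp: mat_def intro!: prod_zero)
    qed (simp add: mat_def)
    have "?D H = (\<Sum>p | p permutes (UNIV::'n set). if p = id then trace H else 0)"
      by (intro sum.cong refl) (auto simp: z trace_def)
    also have "\<dots> = trace H"
      by (simp add: permutes_id finite_permutations flip: id_def)
    finally show "?D H = trace H" .
  qed
  ultimately show ?thesis by simp
qed

lemma matrix_inv_mult:
  fixes G :: "real^'n^'n"
  assumes "invertible G"
  shows "G ** matrix_inv G = mat 1" "matrix_inv G ** G = mat 1"
  using someI_ex[OF assms[unfolded invertible_def]] by (simp_all only: matrix_inv_def)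

text \<open>Jacobi's formula: \<open>det M = det G * det (matrix_inv G ** M)\<close> moves the
  computation to the identity matrix.\<close>

lemma has_derivative_det:
  fixes G :: "real^'n^'n"
  assumes "invertible G"
  shows "(det has_derivative (\<lambda>H. det G * trace (matrix_inv G ** H))) (at G)"
proof -
  note G = matrix_inv_mult[OF assms]
  have bl: "bounded_linear (\<lambda>M. matrix_inv G ** M)"
    by (rule linear_conv_bounded_linear[THEN iffD1])
       (auto intro!: linearI simp: matrix_add_ldistrib vec_eq_iff matrix_matrix_mult_def sum_distrib_left sum.distrib algebra_simps)
  have 1: "((\<lambda>M. matrix_inv G ** M) has_derivative (\<lambda>M. matrix_inv G ** M)) (at G)"
    by (rule bounded_linear_imp_has_derivative[OF bl])
  have "((\<lambda>M. det (matrix_inv G ** M)) has_derivative (\<lambda>H. trace (matrix_inv G ** H))) (at G)"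
    using has_derivative_compose[OF 1, of det trace] has_derivative_det_mat_1 G by simp
  then have "((\<lambda>M. det G * det (matrix_inv G ** M)) has_derivative
      (\<lambda>H. det G * trace (matrix_inv G ** H))) (at G)"
    by (rule has_derivative_mult_right)
  moreover have "det G * det (matrix_inv G ** M) = det M" for M
    by (simp add: det_mul[symmetric] matrix_mul_assoc G)
  ultimately show ?thesis by simp
qed

section \<open>Calculus of partial derivatives in a chart\<close>

abbreviation diff_ch :: "('m, 'n::finite) chart \<Rightarrow> 'm \<Rightarrow> ('m \<Rightarrow> 'b::real_normed_vector) \<Rightarrow> bool"
  where "diff_ch c x f \<equiv> (f \<circ> inv_ch c) differentiable (at (map_ch c x))"

lemma smooth_in_imp_diff_ch:
  assumes "smooth_in c f" "x \<in> dom_ch c"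
  shows "diff_ch c x f"
proof -
  have "C_k_on (Suc 0) (map_ch c ` dom_ch c) (f \<circ> inv_ch c)"
    using assms(1) by (simp only: smooth_in_def smooth_on_def)
  then show ?thesis using assms(2) by simp
qed

lemma C_k_on_const: "C_k_on j U (\<lambda>_. w)"
  by (induction j arbitrary: w) auto

lemma smooth_in_const: "smooth_in c (\<lambda>_. v)"
  by (simp add: smooth_in_def smooth_on_def o_def C_k_on_const)

lemma sum_axis_scaleR:
  fixes F :: "'n::finite \<Rightarrow> 'b::real_vector"
  shows "(\<Sum>a\<in>UNIV. (axis b 1 :: real^'n) $ a *\<^sub>R F a) = F b"
proof -
  have "(\<Sum>a\<in>UNIV. (axis b 1 :: real^'n) $ a *\<^sub>R F a) = (\<Sum>a\<in>UNIV. if a = b then F a else 0)"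
    by (intro sum.cong) (auto simp: axis_def)
  then show ?thesis by simp
qed

lemma pd_const [simp]: "pd c a (\<lambda>_. v) x = 0"
  by (simp add: pd_def o_def)

lemma pd_has_derivative:
  assumes "diff_ch c x f"
  shows "((f \<circ> inv_ch c) has_derivative (\<lambda>v. \<Sum>a\<in>UNIV. v$a *\<^sub>R pd c a f x)) (at (map_ch c x))"
proof -
  let ?D = "frechet_derivative (f \<circ> inv_ch c) (at (map_ch c x))"
  have D: "((f \<circ> inv_ch c) has_derivative ?D) (at (map_ch c x))"
    using assms frechet_derivative_works by blast
  have "?D v = (\<Sum>a\<in>UNIV. v$a *\<^sub>R pd c a f x)" for v
  proof -
    have "?D v = ?D (\<Sum>a\<in>UNIV. v$a *\<^sub>R axis a 1)"
      using basis_expansion[of v] by (simp add: scalar_mult_eq_scaleR)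
    also have "\<dots> = (\<Sum>a\<in>UNIV. v$a *\<^sub>R ?D (axis a 1))"
      using has_derivative_linear[OF D] by (simp add: linear_sum linear_cmul)
    finally show ?thesis by (simp add: pd_def)
  qed
  with D show ?thesis by (metis (no_types, lifting) ext)
qed

lemma pd_eqI:
  assumes "((f \<circ> inv_ch c) has_derivative D) (at (map_ch c x))"
  shows "pd c a f x = D (axis a 1)"
  using frechet_derivative_at[OF assms] by (simp add: pd_def)

lemma
  assumes "bounded_linear L" "diff_ch c x f"
  shows pd_bounded_linear: "pd c a (\<lambda>y. L (f y)) x = L (pd c a f x)"
    and diff_ch_bounded_linear: "diff_ch c x (\<lambda>y. L (f y))"
proof -
  from assms(2) obtain D where D: "((f \<circ> inv_ch c) has_derivative D) (at (map_ch c x))"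
    by (auto simp: differentiable_def)
  then have *: "(((\<lambda>y. L (f y)) \<circ> inv_ch c) has_derivative (\<lambda>v. L (D v))) (at (map_ch c x))"
    using bounded_linear.has_derivative[OF assms(1)] by (fastforce simp: o_def)
  show "pd c a (\<lambda>y. L (f y)) x = L (pd c a f x)"
    unfolding pd_eqI[OF *] pd_eqI[OF D] ..
  from * show "diff_ch c x (\<lambda>y. L (f y))" by (auto simp: differentiable_def)
qed

lemma pd_sum:
  assumes "\<And>i. i \<in> I \<Longrightarrow> diff_ch c x (f i)"
  shows "pd c a (\<lambda>y. \<Sum>i\<in>I. f i y) x = (\<Sum>i\<in>I. pd c a (f i) x)"
proof -
  have "((\<lambda>y. \<Sum>i\<in>I. (f i \<circ> inv_ch c) y) has_derivative
      (\<lambda>v. \<Sum>i\<in>I. \<Sum>b\<in>UNIV. v$b *\<^sub>R pd c b (f i) x)) (at (map_ch c x))"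
    by (intro has_derivative_sum pd_has_derivative assms)
  then have "((\<lambda>y. \<Sum>i\<in>I. f i y) \<circ> inv_ch c has_derivative
      (\<lambda>v. \<Sum>i\<in>I. \<Sum>b\<in>UNIV. v$b *\<^sub>R pd c b (f i) x)) (at (map_ch c x))"
    by (simp add: o_def)
  from pd_eqI[OF this] show ?thesis by (simp only: sum_axis_scaleR)
qed

lemma inv_ch_map_ch:
  assumes "smooth_atlas A" "c \<in> A" "x \<in> dom_ch c"
  shows "inv_ch c (map_ch c x) = x"
  using assms unfolding smooth_atlas_def by (meson homeomorphism_apply1)

lemma pd_mult:
  fixes u v :: "'m::{t2_space, second_countable_topology} \<Rightarrow> real"
  assumes "smooth_atlas A" "c \<in> A" "x \<in> dom_ch c" "diff_ch c x u" "diff_ch c x v"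
  shows "pd c a (\<lambda>y. u y * v y) x = pd c a u x * v x + u x * pd c a v x"
proof -
  have "((\<lambda>y. (u \<circ> inv_ch c) y * (v \<circ> inv_ch c) y) has_derivative
     (\<lambda>w. (u \<circ> inv_ch c) (map_ch c x) * (\<Sum>a\<in>UNIV. w$a *\<^sub>R pd c a v x)
       + (\<Sum>a\<in>UNIV. w$a *\<^sub>R pd c a u x) * (v \<circ> inv_ch c) (map_ch c x))) (at (map_ch c x))"
    by (intro has_derivative_mult pd_has_derivative assms)
  then have "((\<lambda>y. u y * v y) \<circ> inv_ch c has_derivative
     (\<lambda>w. u x * (\<Sum>a\<in>UNIV. w$a *\<^sub>R pd c a v x)
       + (\<Sum>a\<in>UNIV. w$a *\<^sub>R pd c a u x) * v x)) (at (map_ch c x))"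
    by (simp add: o_def inv_ch_map_ch[OF assms(1-3)])
  from pd_eqI[OF this] show ?thesis by (simp only: sum_axis_scaleR add.commute)
qed

text \<open>A coordinate ball is convex, so a vanishing derivative forces a constant there;
  \<open>T\<close> is the preimage of such a ball under the chart.\<close>

lemma pd_zero_imp_locally_constant:
  fixes f :: "'m::{t2_space, second_countable_topology} \<Rightarrow> real"
  assumes A: "smooth_atlas A" "c \<in> A" and x: "x \<in> dom_ch c"
    and d: "\<And>y. y \<in> dom_ch c \<Longrightarrow> diff_ch c y f"
    and z: "\<And>y a. y \<in> dom_ch c \<Longrightarrow> pd c a f y = 0"
  shows "\<exists>T. open T \<and> x \<in> T \<and> T \<subseteq> dom_ch c \<and> (\<forall>y\<in>T. f y = f x)"
proof -
  let ?U = "map_ch c ` dom_ch c"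
  have oU: "open ?U" and oD: "open (dom_ch c)"
    and hm: "homeomorphism (dom_ch c) ?U (map_ch c) (inv_ch c)"
    using A by (simp_all add: smooth_atlas_def)
  obtain e where e: "e > 0" "ball (map_ch c x) e \<subseteq> ?U"
    using oU x by (meson imageI open_contains_ball)
  let ?T = "dom_ch c \<inter> map_ch c -` ball (map_ch c x) e"
  have "open ?T"
    using homeomorphism_cont1[OF hm] oD by (intro continuous_open_preimage) auto
  moreover have "f y = f x" if "y \<in> ?T" for y
  proof -
    have "((f \<circ> inv_ch c) has_derivative (\<lambda>_. 0)) (at w within ball (map_ch c x) e)"
      if "w \<in> ball (map_ch c x) e" for w
    proof -
      from that e obtain u where "u \<in> dom_ch c" "w = map_ch c u" by blast
      then show ?thesis
        using pd_has_derivative[OF d, of u] z[of u] by (simp add: has_derivative_at_withinI)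
    qed
    from has_derivative_zero_constant[OF convex_ball this]
    obtain K where K: "(f \<circ> inv_ch c) w = K" if "w \<in> ball (map_ch c x) e" for w by blast
    have "(f \<circ> inv_ch c) (map_ch c y) = (f \<circ> inv_ch c) (map_ch c x)"
      using K[of "map_ch c x"] K[of "map_ch c y"] that e(1) by simp
    with that x show ?thesis by (simp add: inv_ch_map_ch[OF A])
  qed
  moreover have "x \<in> ?T" "?T \<subseteq> dom_ch c" using x e(1) by auto
  ultimately show ?thesis by blast
qed

text \<open>The determinant of an indefinite metric may be negative, so both signs of
  \<open>t\<close> matter. Writing the power as \<open>(t * t) powr (\<alpha> / 2)\<close> treats
  them together.\<close>

lemma has_real_derivative_abs_powr:
  fixes t \<alpha> :: real
  assumes "t \<noteq> 0"
  shows "((\<lambda>t. \<bar>t\<bar> powr \<alpha>) has_real_derivative \<alpha> * \<bar>t\<bar> powr \<alpha> / t) (at t)"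
proof -
  have eq: "\<bar>u\<bar> powr \<alpha> = (u * u) powr (\<alpha> / 2)" for u :: real
  proof (cases "u = 0")
    case False
    then have "u * u = \<bar>u\<bar> powr 2" by (simp add: power2_eq_square)
    then show ?thesis by (simp only: powr_powr) simp
  qed simp
  have pos: "t * t > 0" using assms by (simp add: zero_less_mult_iff) linarith
  have "((\<lambda>t. (t * t) powr (\<alpha> / 2)) has_real_derivative (\<alpha> / 2) * (t * t) powr (\<alpha> / 2 - 1) * (2 * t)) (at t)"
    by (rule DERIV_chain2[where g = "\<lambda>t. t * t" and x = t, OF has_real_derivative_powr[OF pos]]) (auto intro!: derivative_eq_intros)
  moreover have "(\<alpha> / 2) * (t * t) powr (\<alpha> / 2 - 1) * (2 * t) = \<alpha> * \<bar>t\<bar> powr \<alpha> / t"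
    using assms pos by (simp add: eq powr_diff)
  ultimately show ?thesis by (simp add: eq)
qed

lemma matrix_vector_mult_uminus: "M *v (- v) = - (M *v v :: real^'m)"
  by (rule linear_neg[OF matrix_vector_mul_linear])

lemma vec_lambda_zero [simp]: "(\<chi> i. 0) = 0"
  by (simp add: vec_eq_iff)

section \<open>A parallel adjoint tractor in a fixed chart and scale\<close>

text \<open>In one chart and one metric of the class, tractor sections are functions into a single
  vector space, so \<open>S\<close> can be differentiated against constant component vectors. Gluing
  over charts and metrics comes afterwards.\<close>

locale adjoint_tractor_in_scale =
  fixes A :: "('m::{t2_space, second_countable_topology}, 'n::finite) chart set"
    and c :: "('m, 'n) chart" and g :: "('m, 'n) metric_field" and p q :: nat
    and S :: "'m \<Rightarrow> 'n tractor \<Rightarrow> 'n tractor" and k :: "'m \<Rightarrow> real^'n"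
  assumes atlas: "smooth_atlas A" and chart: "c \<in> A" and metric: "pseudo_metric A p q g"
    and smooth_S: "smooth_in c (\<lambda>x. S x v)"
    and linear_S: "x \<in> dom_ch c \<Longrightarrow> linear (S x)"
    and skew_S: "x \<in> dom_ch c \<Longrightarrow>
      tractor_metric c g x (S x v) w + tractor_metric c g x v (S x w) = 0"
    and parallel_S: "smooth_in c t \<Longrightarrow> x \<in> dom_ch c \<Longrightarrow> nabla_adjoint c g a S t x = 0"
    and smooth_k: "smooth_in c k"
    and underlying_k: "x \<in> dom_ch c \<Longrightarrow>
      \<exists>r. S x (0, 0, \<rho>) = (0, (- \<rho>) *\<^sub>R (conf_metric c g x *v k x), r)"
    and isotropic_k: "x \<in> dom_ch c \<Longrightarrow> k x \<bullet> (conf_metric c g x *v k x) = 0"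
begin

section \<open>Algebra of the conformal metric and the tractor metric\<close>

abbreviation G :: "'m \<Rightarrow> real^'n^'n" where "G x \<equiv> conf_metric c g x"
abbreviation Gi :: "'m \<Rightarrow> real^'n^'n" where "Gi x \<equiv> matrix_inv (G x)"

lemma g_sym: "x \<in> dom_ch c \<Longrightarrow> transpose (g c x) = g c x"
  and g_invertible: "x \<in> dom_ch c \<Longrightarrow> invertible (g c x)"
  using metric chart unfolding pseudo_metric_def by blast+

lemma g_sym_component: "x \<in> dom_ch c \<Longrightarrow> g c x $ a $ b = g c x $ b $ a"
  using arg_cong[OF g_sym, of x "\<lambda>M. M $ b $ a"] by (simp add: transpose_def)

lemma det_g_nz: "x \<in> dom_ch c \<Longrightarrow> det (g c x) \<noteq> 0"
  using g_invertible invertible_det_nz by blast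

text \<open>The density of weight 2 that turns \<open>g\<close> into the conformal metric.\<close>

definition \<phi> :: "'m \<Rightarrow> real" where "\<phi> x = \<bar>det (g c x)\<bar> powr (- 1 / real CARD('n))"

lemma G_eq: "G x = \<phi> x *\<^sub>R g c x"
  by (simp add: conf_metric_def \<phi>_def)

lemma \<phi>_nz: "x \<in> dom_ch c \<Longrightarrow> \<phi> x \<noteq> 0"
  using det_g_nz by (simp add: \<phi>_def)

lemma G_sym: "x \<in> dom_ch c \<Longrightarrow> G x $ a $ b = G x $ b $ a"
  by (simp add: G_eq g_sym_component[of x a b])

lemma G_transpose: "x \<in> dom_ch c \<Longrightarrow> transpose (G x) = G x"
  by (simp add: transpose_def vec_eq_iff G_sym)

lemma G_invertible:
  assumes "x \<in> dom_ch c"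
  shows "invertible (G x)"
proof -
  have "G x = (\<chi> i. \<phi> x *s (g c x $ i))" by (simp add: G_eq vec_eq_iff)
  then have "det (G x) = \<phi> x ^ CARD('n) * det (g c x)" by (simp add: det_rows_mul)
  then show ?thesis using \<phi>_nz[OF assms] det_g_nz[OF assms] by (simp add: invertible_det_nz)
qed

lemma G_Gi: "x \<in> dom_ch c \<Longrightarrow> G x ** Gi x = mat 1" "x \<in> dom_ch c \<Longrightarrow> Gi x ** G x = mat 1"
  using matrix_inv_mult[OF G_invertible] by blast+

lemma Gi_transpose: assumes "x \<in> dom_ch c" shows "transpose (Gi x) = Gi x"
proof -
  have "transpose (Gi x) ** G x = mat 1"
    using arg_cong[OF G_Gi(1)[OF assms], of transpose]
    by (simp add: matrix_transpose_mul G_transpose assms transpose_mat)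
  then have "transpose (Gi x) ** (G x ** Gi x) = Gi x"
    by (simp add: matrix_mul_assoc)
  then show ?thesis by (simp add: G_Gi assms)
qed

lemma Gi_G_vec: "x \<in> dom_ch c \<Longrightarrow> Gi x *v (G x *v v) = v"
  by (simp add: matrix_vector_mul_assoc G_Gi)

lemma inner_Gi_sym: "x \<in> dom_ch c \<Longrightarrow> v \<bullet> (Gi x *v w) = w \<bullet> (Gi x *v v)"
  by (metis Gi_transpose dot_lmul_matrix inner_commute transpose_matrix_vector)

text \<open>By symmetry a row is a column, that is, a coordinate vector with its index lowered;
  pairing with it through \<open>Gi\<close> then extracts a component.\<close>

lemma G_row: "x \<in> dom_ch c \<Longrightarrow> G x $ a = G x *v axis a 1"
  by (simp add: vec_eq_iff matrix_vector_mult_basis column_def G_sym)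

lemma inner_Gi_G_row: "x \<in> dom_ch c \<Longrightarrow> v \<bullet> (Gi x *v (G x $ a)) = v $ a"
  by (simp add: G_row Gi_G_vec inner_axis)

abbreviation tm :: "'m \<Rightarrow> 'n tractor \<Rightarrow> 'n tractor \<Rightarrow> real" where "tm \<equiv> tractor_metric c g"

lemma tm_sym: "x \<in> dom_ch c \<Longrightarrow> tm x v w = tm x w v"
  using inner_Gi_sym[of x "fst (snd v)" "fst (snd w)"]
  by (cases v; cases w) (simp add: tractor_metric_def)

lemma tm_top: "tm x v (0, 0, 1) = fst v"
  by (cases v) (simp add: tractor_metric_def)

text \<open>With \<open>tm_top\<close>, this reads off the first two slots of a tractor by pairing
  it with \<open>X\<close> and with \<open>W_a = (0, G x $ a, 0)\<close>.\<close>

lemma tm_row: "x \<in> dom_ch c \<Longrightarrow> tm x v (0, G x $ a, 0) = fst (snd v) $ a"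
  by (cases v) (simp add: tractor_metric_def inner_Gi_G_row)

text \<open>The two signs from skewness cancel. This symmetry later carries known values of
  \<open>S \<circ> S\<close> over to unknown slots.\<close>

lemma tm_square: "x \<in> dom_ch c \<Longrightarrow> tm x (S x (S x v)) w = tm x v (S x (S x w))"
  using skew_S[of x "S x v" w] skew_S[of x v "S x w"] by simp

section \<open>The tractor connection in components, and parallelism\<close>

definition contracted_christoffel :: "'n \<Rightarrow> 'm \<Rightarrow> real" where
  "contracted_christoffel a x = (\<Sum>b\<in>UNIV. christoffel c g b a b x) / real CARD('n)"

text \<open>The connection form on densities of weight 1; on weight \<open>w\<close> it is
  multiplied by \<open>w\<close>.\<close>

abbreviation \<theta> where "\<theta> \<equiv> contracted_christoffel"

text \<open>The zeroth-order part of the tractor connection: covariant differentiation is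
  \<open>pd c a\<close> plus \<open>conn a\<close>. The slots have weights 1, 1 and -1, whence the
  signs of the terms with \<open>\<theta>\<close>.\<close>

definition conn :: "'n \<Rightarrow> 'm \<Rightarrow> 'n tractor \<Rightarrow> 'n tractor" where
  "conn a x = (\<lambda>(\<sigma>, \<mu>, \<rho>).
     (\<theta> a x * \<sigma> - \<mu> $ a,
      \<theta> a x *\<^sub>R \<mu> - (\<chi> b. \<Sum>e\<in>UNIV. christoffel c g e a b x * \<mu> $ e)
        + \<rho> *\<^sub>R (G x $ a) + \<sigma> *\<^sub>R (schouten c g x $ a),
      - \<theta> a x * \<rho> - (schouten c g x $ a) \<bullet> (Gi x *v \<mu>)))"

lemma linear_conn: "linear (conn a x)"
proof (rule linearI)
  let ?\<Gamma> = "\<lambda>b e. christoffel c g e a b x"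
  show "conn a x (v + w) = conn a x v + conn a x w" for v w
  proof -
    have "(\<Sum>e\<in>UNIV. ?\<Gamma> b e * (\<mu> $ e + \<mu>' $ e))
        = (\<Sum>e\<in>UNIV. ?\<Gamma> b e * \<mu> $ e) + (\<Sum>e\<in>UNIV. ?\<Gamma> b e * \<mu>' $ e)" for b and \<mu> \<mu>' :: "real^'n"
      by (simp add: distrib_left sum.distrib)
    then show ?thesis
      by (cases v; cases w) (simp add: conn_def vec_eq_iff algebra_simps inner_add_right)
  qed
  show "conn a x (l *\<^sub>R v) = l *\<^sub>R conn a x v" for l v
  proof -
    have "(\<Sum>e\<in>UNIV. ?\<Gamma> b e * (l * \<mu> $ e)) = l * (\<Sum>e\<in>UNIV. ?\<Gamma> b e * \<mu> $ e)" for b and \<mu> :: "real^'n"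
      by (simp add: sum_distrib_left mult.left_commute)
    then show ?thesis
      by (cases v) (simp add: conn_def vec_eq_iff matrix_vector_mult_scaleR right_diff_distrib distrib_left mult.left_commute)
  qed
qed

lemma bounded_linear_fst_snd: "bounded_linear (\<lambda>v :: 'n tractor. fst (snd v))"
  by (rule bounded_linear_compose[OF bounded_linear_fst bounded_linear_snd])

lemma bounded_linear_snd_snd: "bounded_linear (\<lambda>v :: 'n tractor. snd (snd v))"
  by (rule bounded_linear_compose[OF bounded_linear_snd bounded_linear_snd])

lemma bounded_linear_component: "bounded_linear (\<lambda>v :: 'n tractor. fst (snd v) $ b)"
  by (rule bounded_linear_compose[OF bounded_linear_vec_nth bounded_linear_fst_snd])

lemma nabla_tractor_eq:
  assumes "diff_ch c x t"
  shows "nabla_tractor c g a t x = pd c a t x + conn a x (t x)"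
proof -
  note pd_bounded_linear[OF bounded_linear_fst assms, of a]
    pd_bounded_linear[OF bounded_linear_component assms, of a]
    pd_bounded_linear[OF bounded_linear_snd_snd assms, of a]
  then show ?thesis
    by (cases "t x"; cases "pd c a t x")
       (simp add: nabla_tractor_def Let_def conn_def nabla_covec_def nabla_dens_def
          contracted_christoffel_def vec_eq_iff algebra_simps)
qed

lemma diff_S: "x \<in> dom_ch c \<Longrightarrow> diff_ch c x (\<lambda>y. S y v)"
  by (rule smooth_in_imp_diff_ch[OF smooth_S])

text \<open>Parallelism tested on a section with constant components, whose partial derivatives
  vanish: the derivative of \<open>S\<close> is a commutator with \<open>conn\<close>.\<close>

lemma pd_S:
  assumes "x \<in> dom_ch c"
  shows "pd c a (\<lambda>y. S y v) x = S x (conn a x v) - conn a x (S x v)"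
  using parallel_S[OF smooth_in_const assms, of a v]
    smooth_in_imp_diff_ch[OF smooth_in_const assms, of v]
  by (simp add: nabla_adjoint_def nabla_tractor_eq diff_S assms eq_diff_eq)

lemma diff_SS: assumes x: "x \<in> dom_ch c" shows "diff_ch c x (\<lambda>y. S y (S y v))"
proof -
  have lin: "linear (S x')" if "x' \<in> dom_ch c" for x' using linear_S that .
  \<comment> \<open>Expanding \<open>S y v\<close> in a fixed basis turns the composition into a
    finite sum of products of differentiable functions.\<close>
  let ?f = "\<lambda>y. \<Sum>b\<in>Basis. (S y v \<bullet> b) *\<^sub>R S y b"
  have eq: "S y (S y v) = ?f y" if "y \<in> dom_ch c" for y
  proof -
    have "S y (S y v) = S y (\<Sum>b\<in>Basis. (S y v \<bullet> b) *\<^sub>R b)" by (simp add: euclidean_representation)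
    also have "\<dots> = ?f y" using lin[OF that] by (simp add: linear_sum linear_cmul)
    finally show ?thesis .
  qed
  have D: "(\<lambda>y. S (inv_ch c y) w) differentiable (at (map_ch c x))" for w
    using diff_S[OF x, of w] by (simp add: o_def)
  have "(\<lambda>y. \<Sum>b\<in>Basis. (S (inv_ch c y) v \<bullet> b) *\<^sub>R S (inv_ch c y) b) differentiable (at (map_ch c x))"
    by (intro differentiable_sum ballI differentiable_scaleR differentiable_inner differentiable_const D) auto
  then obtain D' where D': "(?f \<circ> inv_ch c has_derivative D') (at (map_ch c x))"
    by (auto simp: o_def differentiable_def)
  have op: "open (map_ch c ` dom_ch c)" using atlas chart by (simp add: smooth_atlas_def)
  have "((\<lambda>y. S y (S y v)) \<circ> inv_ch c has_derivative D') (at (map_ch c x))"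
    by (rule has_derivative_transform_within_open[OF D' op]) (use x in \<open>auto simp: eq inv_ch_map_ch[OF atlas chart]\<close>)
  then show ?thesis by (auto simp: differentiable_def)
qed

text \<open>Parallelism is tested on the section \<open>S v\<close>, and \<open>pd_S\<close>
  rewrites the inner derivative: \<open>S \<circ> S\<close> is parallel as well.\<close>

lemma pd_SS:
  assumes x: "x \<in> dom_ch c"
  shows "pd c a (\<lambda>y. S y (S y v)) x = S x (S x (conn a x v)) - conn a x (S x (S x v))"
  using parallel_S[OF smooth_S x, of a v] diff_SS[OF x] diff_S[OF x] linear_S[OF x]
  by (simp add: nabla_adjoint_def nabla_tractor_eq pd_S x linear_diff linear_add algebra_simps)

section \<open>The slots of \<open>S \<circ> S\<close>\<close>

definition K :: "'m \<Rightarrow> real^'n" where "K x = G x *v k x"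
definition r :: "'m \<Rightarrow> real" where "r x = snd (snd (S x (0, 0, 1)))"
text \<open>\<open>\<nu>\<close>, \<open>\<omega>\<close> and \<open>lam\<close> are the unknowns in
  terms of which all slots of \<open>S \<circ> S\<close> are computed; \<open>lam\<close> is still a
  function here.\<close>

definition \<nu> :: "'m \<Rightarrow> real^'n \<Rightarrow> real" where "\<nu> x \<mu> = snd (snd (S x (S x (0, \<mu>, 0))))"
definition \<omega> :: "'m \<Rightarrow> real" where "\<omega> x = snd (snd (S x (S x (1, 0, 0))))"
definition lam :: "'m \<Rightarrow> real" where "lam x = snd (snd (S x (S x (0, 0, 1))))"

lemma S_top: "x \<in> dom_ch c \<Longrightarrow> S x (0, 0, 1) = (0, - K x, r x)"
  using underlying_k[of x 1] by (auto simp: K_def r_def)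

text \<open>\<open>X\<close> has constant components, but its nonzero slot has weight -1, which
  contributes the term with \<open>\<theta>\<close>. Up to that term
  \<open>\<nabla>\<^sub>a X = W_a\<close>, so differentiating \<open>X\<close> produces the middle
  slot.\<close>

lemma conn_top: "conn a x (0, 0, 1) = (0, G x $ a, 0) - \<theta> a x *\<^sub>R (0, 0, 1)"
  by (simp add: conn_def vec_eq_iff)

text \<open>The top slot is the pairing with \<open>X\<close>, which skewness turns into minus the
  squared length of \<open>S X\<close>, that is, into \<open>- k\<^sup>a k\<^sub>a\<close>.\<close>

lemma fst_SS_top:
  assumes x: "x \<in> dom_ch c"
  shows "fst (S x (S x (0, 0, 1))) = 0"
proof -
  have "fst (S x (S x (0, 0, 1))) = - tm x (S x (0, 0, 1)) (S x (0, 0, 1))"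
    using skew_S[OF x, of "S x (0, 0, 1)" "(0, 0, 1)"] by (simp add: tm_top)
  also have "\<dots> = 0"
    using isotropic_k[OF x]
    by (simp add: S_top x tractor_metric_def K_def Gi_G_vec matrix_vector_mult_uminus inner_commute)
  finally show ?thesis .
qed

text \<open>Differentiating \<open>h (s X) (s X) = 0\<close> shows that \<open>s (s X)\<close> is orthogonal to \<open>X\<close> and
  \<open>\<nabla>X\<close>, hence a multiple of \<open>X\<close>.\<close>

lemma SS_top:
  assumes x: "x \<in> dom_ch c"
  shows "S x (S x (0, 0, 1)) = (0, 0, lam x)"
proof -
  let ?X = "(0, 0, 1) :: 'n tractor"
  have "fst (snd (S x (S x ?X))) $ a = 0" for a
  proof -
    let ?W = "(0, G x $ a, 0) :: 'n tractor"
    have "pd c a (\<lambda>y. fst (S y (S y ?X))) x = pd c a (\<lambda>_. 0 :: real) x"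
      by (rule pd_cong[OF atlas chart x]) (simp add: fst_SS_top)
    moreover have "pd c a (\<lambda>y. fst (S y (S y ?X))) x = fst (pd c a (\<lambda>y. S y (S y ?X)) x)"
      by (rule pd_bounded_linear[OF bounded_linear_fst diff_SS[OF x]])
    moreover have "fst (conn a x (S x (S x ?X))) = - fst (snd (S x (S x ?X))) $ a"
      using fst_SS_top[OF x] by (cases "S x (S x ?X)") (simp add: conn_def)
    moreover have "fst (S x (S x (conn a x ?X))) = fst (S x (S x ?W)) - \<theta> a x * fst (S x (S x ?X))"
      unfolding conn_top linear_diff[OF linear_S[OF x]] linear_cmul[OF linear_S[OF x]] by simp
    \<comment> \<open>By symmetry this term equals the one that the connection contributes when
      acting on \<open>S (S X)\<close>, so the vanishing derivative is twice the middle
      slot.\<close>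
    moreover have "fst (S x (S x ?W)) = fst (snd (S x (S x ?X))) $ a"
      using tm_square[OF x, of ?W ?X] tm_sym[OF x, of ?W] by (simp add: tm_top tm_row x)
    ultimately show ?thesis by (simp add: pd_SS x fst_SS_top)
  qed
  then have "fst (snd (S x (S x ?X))) = 0" by (simp add: vec_eq_iff)
  with fst_SS_top[OF x] show ?thesis by (simp add: lam_def prod_eq_iff)
qed

lemma diff_lam: "x \<in> dom_ch c \<Longrightarrow> diff_ch c x lam"
  using diff_ch_bounded_linear[OF bounded_linear_snd_snd diff_SS]
  unfolding lam_def[abs_def] .

lemma SS_add: "x \<in> dom_ch c \<Longrightarrow> S x (S x (v + w)) = S x (S x v) + S x (S x w)"
  and SS_diff: "x \<in> dom_ch c \<Longrightarrow> S x (S x (v - w)) = S x (S x v) - S x (S x w)"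
  and SS_scaleR: "x \<in> dom_ch c \<Longrightarrow> S x (S x (l *\<^sub>R v)) = l *\<^sub>R S x (S x v)"
  using linear_S by (simp_all add: linear_add linear_diff linear_cmul)

text \<open>Differentiating \<open>S (S X) = lam X\<close> gives the value of
  \<open>S \<circ> S\<close> on \<open>\<nabla>\<^sub>a X\<close>; the terms with
  \<open>\<theta>\<close> cancel.\<close>

lemma SS_row:
  assumes x: "x \<in> dom_ch c"
  shows "S x (S x (0, G x $ a, 0)) = (0, lam x *\<^sub>R (G x $ a), pd c a lam x)"
proof -
  let ?X = "(0, 0, 1) :: 'n tractor" and ?W = "(0, G x $ a, 0) :: 'n tractor"
  have *: "S y (S y ?X) = lam y *\<^sub>R ?X" if "y \<in> dom_ch c" for y
    by (simp add: SS_top that)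
  have "pd c a (\<lambda>y. S y (S y ?X)) x = pd c a (\<lambda>y. lam y *\<^sub>R ?X) x"
    by (rule pd_cong[OF atlas chart x]) (rule *)
  also have "\<dots> = pd c a lam x *\<^sub>R ?X"
    by (rule pd_bounded_linear[OF bounded_linear_scaleR_left diff_lam[OF x]])
  finally have "S x (S x (conn a x ?X)) = pd c a lam x *\<^sub>R ?X + conn a x (lam x *\<^sub>R ?X)"
    unfolding pd_SS[OF x] *[OF x] by (simp add: algebra_simps)
  moreover have "S x (S x (conn a x ?X)) = S x (S x ?W) - \<theta> a x *\<^sub>R lam x *\<^sub>R ?X"
    unfolding conn_top SS_diff[OF x] SS_scaleR[OF x] *[OF x] ..
  ultimately have "S x (S x ?W) = pd c a lam x *\<^sub>R ?X + conn a x (lam x *\<^sub>R ?X) + \<theta> a x *\<^sub>R lam x *\<^sub>R ?X"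
    by (simp only: diff_eq_eq)
  then show ?thesis by (simp add: conn_def)
qed

text \<open>Symmetry moves \<open>S \<circ> S\<close> onto \<open>X\<close> and \<open>W_b\<close>,
  where \<open>SS_top\<close> and \<open>SS_row\<close> give its values.\<close>

lemma SS_mid:
  assumes x: "x \<in> dom_ch c"
  shows "S x (S x (0, \<mu>, 0)) = (0, lam x *\<^sub>R \<mu>, \<nu> x \<mu>)"
proof -
  have "fst (S x (S x (0, \<mu>, 0))) = 0"
    using tm_square[OF x, of "(0, \<mu>, 0)" "(0, 0, 1)"]
    by (simp add: tm_top SS_top x) (simp add: tractor_metric_def)
  moreover have "fst (snd (S x (S x (0, \<mu>, 0)))) $ b = lam x * \<mu> $ b" for b
    using tm_square[OF x, of "(0, \<mu>, 0)" "(0, G x $ b, 0)"]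
    by (simp add: tm_row SS_row x)
       (simp add: tractor_metric_def inner_Gi_G_row x matrix_vector_mult_scaleR)
  ultimately show ?thesis by (simp add: prod_eq_iff vec_eq_iff \<nu>_def \<omega>_def)
qed

lemma SS_bot:
  assumes x: "x \<in> dom_ch c"
  shows "S x (S x (1, 0, 0)) = (lam x, (\<chi> b. pd c b lam x), \<omega> x)"
proof -
  have "fst (S x (S x (1, 0, 0))) = lam x"
    using tm_square[OF x, of "(1, 0, 0)" "(0, 0, 1)"]
    by (simp add: tm_top SS_top x) (simp add: tractor_metric_def)
  moreover have "fst (snd (S x (S x (1, 0, 0)))) $ b = pd c b lam x" for b
    using tm_square[OF x, of "(1, 0, 0)" "(0, G x $ b, 0)"]
    by (simp add: tm_row SS_row x) (simp add: tractor_metric_def)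
  ultimately show ?thesis by (simp add: prod_eq_iff vec_eq_iff \<nu>_def \<omega>_def)
qed

lemma SS_tuple:
  assumes x: "x \<in> dom_ch c"
  shows "S x (S x (\<sigma>, \<mu>, \<rho>)) = \<sigma> *\<^sub>R S x (S x (1, 0, 0)) + S x (S x (0, \<mu>, 0)) + (0, 0, \<rho> * lam x)"
proof -
  have "(\<sigma>, \<mu>, \<rho>) = \<sigma> *\<^sub>R (1, 0, 0) + (0, \<mu>, 0) + \<rho> *\<^sub>R (0, 0, 1 :: real)" by simp
  also have "S x (S x \<dots>) = \<sigma> *\<^sub>R S x (S x (1, 0, 0)) + S x (S x (0, \<mu>, 0)) + \<rho> *\<^sub>R S x (S x (0, 0, 1))"
    by (simp only: SS_add SS_scaleR x)
  finally show ?thesis by (simp add: SS_top x)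
qed

lemma \<nu>_expand:
  assumes x: "x \<in> dom_ch c"
  shows "\<nu> x \<mu> = (\<Sum>a\<in>UNIV. \<mu> $ a * \<nu> x (axis a 1))"
proof -
  have lin: "linear (\<nu> x)"
  proof (rule linearI)
    show "\<nu> x (v + w) = \<nu> x v + \<nu> x w" for v w
      using SS_add[OF x, of "(0, v, 0)" "(0, w, 0)"] by (simp add: \<nu>_def)
    show "\<nu> x (l *\<^sub>R v) = l *\<^sub>R \<nu> x v" for l v
      using SS_scaleR[OF x, of l "(0, v, 0)"] by (simp add: \<nu>_def)
  qed
  have "\<mu> = (\<Sum>a\<in>UNIV. \<mu> $ a *\<^sub>R axis a 1)"
    using basis_expansion[of \<mu>] by (simp add: scalar_mult_eq_scaleR)
  from arg_cong[OF this, of "\<nu> x"] show ?thesis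
    unfolding linear_sum[OF lin] linear_cmul[OF lin] by simp
qed

text \<open>Thus \<open>\<nu>\<close> is the differential of \<open>lam\<close> with its index
  raised.\<close>

lemma \<nu>_row: "x \<in> dom_ch c \<Longrightarrow> \<nu> x (G x $ a) = pd c a lam x"
  by (simp add: \<nu>_def SS_row)

text \<open>The \<open>\<mu>\<close>- and \<open>\<rho>\<close>-slots of \<open>\<nabla>\<^sub>b (s (s Z))\<close> for a frame section \<open>Z\<close> of the middle slot.\<close>

lemma pd_SS_axis:
  assumes x: "x \<in> dom_ch c"
  shows "pd c b lam x * axis a 1 $ d + \<nu> x (axis a 1) * G x $ b $ d = - (axis a 1 $ b * pd c d lam x)"
    and "pd c b (\<lambda>y. \<nu> y (axis a 1)) x
      = \<nu> x (fst (snd (conn b x (0, axis a 1, 0)))) + \<theta> b x * \<nu> x (axis a 1) - axis a 1 $ b * \<omega> x"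
proof -
  let ?Z = "(0, axis a 1, 0) :: 'n tractor"
  obtain \<sigma> C D where CD: "conn b x ?Z = (\<sigma>, C, D)" by (cases "conn b x ?Z")
  then have \<sigma>: "\<sigma> = - (axis a 1 $ b)" by (simp add: conn_def)
  have "conn b x (0, lam x *\<^sub>R axis a 1, \<nu> x (axis a 1))
      = conn b x (lam x *\<^sub>R ?Z + \<nu> x (axis a 1) *\<^sub>R (0, 0, 1))" by simp
  also have "\<dots> = lam x *\<^sub>R conn b x ?Z + \<nu> x (axis a 1) *\<^sub>R conn b x (0, 0, 1)"
    by (simp only: linear_add[OF linear_conn] linear_cmul[OF linear_conn])
  finally have *: "pd c b (\<lambda>y. S y (S y ?Z)) x =
      \<sigma> *\<^sub>R (lam x, (\<chi> b. pd c b lam x), \<omega> x) + (0, lam x *\<^sub>R C, \<nu> x C) + (0, 0, D * lam x)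
        - (lam x *\<^sub>R (\<sigma>, C, D) + \<nu> x (axis a 1) *\<^sub>R ((0, G x $ b, 0) - \<theta> b x *\<^sub>R (0, 0, 1)))"
    unfolding pd_SS[OF x] SS_mid[OF x, of "axis a 1"] CD SS_tuple[OF x, of \<sigma> C D] SS_bot[OF x]
        SS_mid[OF x, of C] by (simp only: conn_top)
  \<comment> \<open>On the whole chart the middle slot of \<open>S (S Z)\<close> is
    \<open>lam\<close> times a constant vector. Comparing its derivative with \<open>*\<close>,
    where the terms \<open>lam x *\<^sub>R C\<close> cancel, gives the first identity.\<close>
  have "pd c b (\<lambda>y. fst (snd (S y (S y ?Z))) $ d) x
      = pd c b (\<lambda>y. lam y *\<^sub>R ((axis a 1 :: real^'n) $ d)) x"
    by (rule pd_cong[OF atlas chart x]) (simp add: SS_mid)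
  also have "\<dots> = pd c b lam x *\<^sub>R ((axis a 1 :: real^'n) $ d)"
    by (rule pd_bounded_linear[OF bounded_linear_scaleR_left diff_lam[OF x]])
  finally have "fst (snd (pd c b (\<lambda>y. S y (S y ?Z)) x)) $ d = pd c b lam x * (axis a 1 :: real^'n) $ d"
    by (simp add: pd_bounded_linear[OF bounded_linear_component diff_SS[OF x]])
  then show "pd c b lam x * axis a 1 $ d + \<nu> x (axis a 1) * G x $ b $ d = - (axis a 1 $ b * pd c d lam x)"
    by (simp add: * \<sigma>)
  have "pd c b (\<lambda>y. \<nu> y (axis a 1)) x = snd (snd (pd c b (\<lambda>y. S y (S y ?Z)) x))"
    unfolding \<nu>_def by (rule pd_bounded_linear[OF bounded_linear_snd_snd diff_SS[OF x]])
  then show "pd c b (\<lambda>y. \<nu> y (axis a 1)) x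
      = \<nu> x (fst (snd (conn b x ?Z))) + \<theta> b x * \<nu> x (axis a 1) - axis a 1 $ b * \<omega> x"
    unfolding * CD by (simp add: \<sigma>)
qed

lemma pd_lam_eq_0:
  assumes x: "x \<in> dom_ch c"
  shows "pd c d lam x = 0"
proof -
  \<comment> \<open>Lowering the index of \<open>\<nu>\<close> again returns the differential of
    \<open>lam\<close>; this copy raises the coefficient from \<open>n + 1\<close> to
    \<open>n + 2\<close>.\<close>
  have "pd c d lam x = (\<Sum>a\<in>UNIV. G x $ a $ d * \<nu> x (axis a 1))"
    using \<nu>_expand[OF x, of "G x $ d"] by (simp add: \<nu>_row x G_sym[OF x, of d])
  also have "\<dots> = (\<Sum>a\<in>UNIV. - pd c d lam x - (if a = d then pd c a lam x else 0))"
  proof (intro sum.cong refl)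
    show "G x $ a $ d * \<nu> x (axis a 1) = - pd c d lam x - (if a = d then pd c a lam x else 0)" for a
      using pd_SS_axis(1)[OF x, where a = a and b = a and d = d]
      by (cases "a = d") (simp_all add: axis_def algebra_simps)
  qed
  also have "\<dots> = - real CARD('n) * pd c d lam x - pd c d lam x"
    by (simp add: sum_subtractf)
  finally have "(real CARD('n) + 2) * pd c d lam x = 0" by (simp add: algebra_simps)
  moreover have "real CARD('n) + 2 \<noteq> 0" by linarith
  ultimately show ?thesis by simp
qed

text \<open>With \<open>lam\<close> of zero derivative, only the term with \<open>\<nu>\<close>
  survives in the first identity of \<open>pd_SS_axis\<close>, and \<open>G x\<close> is
  nonzero.\<close>

lemma \<nu>_eq_0:
  assumes x: "x \<in> dom_ch c"
  shows "\<nu> x \<mu> = 0"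
proof -
  have "\<nu> x (axis a 1) = 0" for a
  proof -
    have "\<nu> x (axis a 1) *\<^sub>R G x = 0"
      using pd_SS_axis(1)[OF x, where a = a] by (simp add: pd_lam_eq_0 x vec_eq_iff)
    moreover have "G x \<noteq> 0"
      using G_invertible[OF x] det_0[where 'a = real and 'n = 'n] by (auto simp: invertible_det_nz mat_0)
    ultimately show ?thesis by simp
  qed
  then show ?thesis by (subst \<nu>_expand[OF x]) simp
qed

text \<open>With equal indices and \<open>\<nu>\<close> identically zero, the second identity of
  \<open>pd_SS_axis\<close> reduces to its last term \<open>- \<omega> x\<close>.\<close>

lemma \<omega>_eq_0:
  assumes x: "x \<in> dom_ch c"
  shows "\<omega> x = 0"
proof -
  have "pd c b (\<lambda>y. \<nu> y (axis b 1)) x = pd c b (\<lambda>_. 0 :: real) x" for b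
    by (rule pd_cong[OF atlas chart x]) (rule \<nu>_eq_0)
  with pd_SS_axis(2)[OF x] show ?thesis by (simp add: \<nu>_eq_0 x)
qed

lemma SS_eq:
  assumes x: "x \<in> dom_ch c"
  shows "S x (S x v) = lam x *\<^sub>R v"
proof -
  obtain \<sigma> \<mu> \<rho> where v: "v = (\<sigma>, \<mu>, \<rho>)" by (cases v)
  show ?thesis
    unfolding v SS_tuple[OF x, of \<sigma> \<mu> \<rho>] SS_bot[OF x] SS_mid[OF x]
    by (simp add: \<nu>_eq_0 \<omega>_eq_0 x pd_lam_eq_0)
qed

section \<open>The eigenvalue in terms of the underlying field\<close>

lemma diff_g: "x \<in> dom_ch c \<Longrightarrow> diff_ch c x (g c)"
  using metric chart by (intro smooth_in_imp_diff_ch) (auto simp: pseudo_metric_def)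

lemma bounded_linear_entry: "bounded_linear (\<lambda>M :: real^'n^'n. M $ i $ j)"
  by (rule bounded_linear_compose[OF bounded_linear_vec_nth bounded_linear_vec_nth])

lemma pd_g:
  assumes x: "x \<in> dom_ch c"
  shows "pd c a (\<lambda>y. g c y $ b $ d) x
    = (\<Sum>e\<in>UNIV. christoffel c g e a b x * g c x $ e $ d) + (\<Sum>e\<in>UNIV. christoffel c g e a d x * g c x $ b $ e)"
  using christoffel_iff[OF atlas metric chart x, of "\<lambda>e a b. christoffel c g e a b x"] by simp

text \<open>Jacobi's formula with metric compatibility: the derivative of \<open>g\<close> splits
  into two Christoffel terms, and each, multiplied by the inverse of \<open>g\<close>, has trace
  \<open>n\<close> times \<open>\<theta>\<close>.\<close>

lemma pd_det_g:
  assumes x: "x \<in> dom_ch c"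
  shows "pd c a (\<lambda>y. det (g c y)) x = det (g c x) * (2 * real CARD('n) * \<theta> a x)"
    and "diff_ch c x (\<lambda>y. det (g c y))"
proof -
  let ?g = "g c x" and ?P = "pd c a (g c) x"
  let ?\<Gamma> = "(\<chi> j e. christoffel c g e a j x) :: real^'n^'n"
  have "(det has_derivative (\<lambda>H. det ?g * trace (matrix_inv ?g ** H))) (at ((g c \<circ> inv_ch c) (map_ch c x)))"
    using has_derivative_det[OF g_invertible[OF x]] by (simp add: inv_ch_map_ch[OF atlas chart x])
  from has_derivative_compose[OF pd_has_derivative[OF diff_g[OF x]] this]
  have *: "((\<lambda>y. det (g c y)) \<circ> inv_ch c has_derivative
      (\<lambda>v. det ?g * trace (matrix_inv ?g ** (\<Sum>a\<in>UNIV. v $ a *\<^sub>R pd c a (g c) x)))) (at (map_ch c x))"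
    by (simp add: o_def)
  then show "diff_ch c x (\<lambda>y. det (g c y))" by (auto simp: differentiable_def)
  have "?P $ j $ i = pd c a (\<lambda>y. g c y $ j $ i) x" for i j
    by (rule pd_bounded_linear[OF bounded_linear_entry diff_g[OF x], symmetric])
  then have "?P = ?\<Gamma> ** ?g + ?g ** transpose ?\<Gamma>"
    by (simp add: vec_eq_iff matrix_matrix_mult_def transpose_def pd_g x mult.commute)
  then have "trace (matrix_inv ?g ** ?P)
      = trace (matrix_inv ?g ** (?\<Gamma> ** ?g)) + trace (matrix_inv ?g ** (?g ** transpose ?\<Gamma>))"
    by (simp add: matrix_add_ldistrib trace_add)
  also have "trace (matrix_inv ?g ** (?\<Gamma> ** ?g)) = trace ?\<Gamma>"
    unfolding trace_mul_sym[of "matrix_inv ?g"] matrix_mul_assoc[symmetric]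
    by (simp add: matrix_inv_mult[OF g_invertible[OF x]])
  also have "trace (matrix_inv ?g ** (?g ** transpose ?\<Gamma>)) = trace ?\<Gamma>"
    unfolding matrix_mul_assoc
    by (simp add: matrix_inv_mult[OF g_invertible[OF x]] trace_def transpose_def)
  finally show "pd c a (\<lambda>y. det (g c y)) x = det ?g * (2 * real CARD('n) * \<theta> a x)"
    using pd_eqI[OF *, of a]
    by (simp only: sum_axis_scaleR) (simp add: trace_def contracted_christoffel_def)
qed

text \<open>As \<open>\<phi>\<close> has weight 2, the formula says that it is parallel for the
  Levi-Civita connection.\<close>

lemma pd_\<phi>:
  assumes x: "x \<in> dom_ch c"
  shows "pd c a \<phi> x = - 2 * \<theta> a x * \<phi> x" and "diff_ch c x \<phi>"
proof -
  let ?d = "\<lambda>y. det (g c y)" and ?n = "real CARD('n)"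
  have "((\<lambda>t. \<bar>t\<bar> powr (- 1 / ?n)) has_derivative (*) (- 1 / ?n * \<phi> x / ?d x)) (at ((?d \<circ> inv_ch c) (map_ch c x)))"
    using has_real_derivative_abs_powr[OF det_g_nz[OF x], of "- 1 / ?n"]
    by (simp add: inv_ch_map_ch[OF atlas chart x] has_field_derivative_def \<phi>_def)
  from has_derivative_compose[OF pd_has_derivative[OF pd_det_g(2)[OF x]] this]
  have *: "(\<phi> \<circ> inv_ch c has_derivative
      (\<lambda>v. - 1 / ?n * \<phi> x / ?d x * (\<Sum>a\<in>UNIV. v $ a *\<^sub>R pd c a ?d x))) (at (map_ch c x))"
    by (simp add: o_def \<phi>_def)
  then show "diff_ch c x \<phi>" by (auto simp: differentiable_def)
  show "pd c a \<phi> x = - 2 * \<theta> a x * \<phi> x"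
    using pd_eqI[OF *, of a] det_g_nz[OF x]
    by (simp only: sum_axis_scaleR pd_det_g(1)[OF x]) (simp add: field_simps)
qed

lemma diff_k: "x \<in> dom_ch c \<Longrightarrow> diff_ch c x (\<lambda>y. k y $ e)"
  by (rule diff_ch_bounded_linear[OF bounded_linear_vec_nth smooth_in_imp_diff_ch[OF smooth_k]])

lemma K_component: "K y $ b = (\<Sum>e\<in>UNIV. \<phi> y * (g c y $ b $ e * k y $ e))"
  by (simp add: K_def G_eq matrix_vector_mult_def mult.assoc)

text \<open>\<open>\<nabla>\<^sub>a (\<phi> g\<^sub>b\<^sub>e k\<^sup>e) = \<phi> g\<^sub>b\<^sub>e \<nabla>\<^sub>a k\<^sup>e\<close>, written out with partial derivatives; the term with \<open>\<theta>\<close>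
  comes from the weight of the density \<open>\<phi>\<close>.\<close>

lemma pd_K:
  assumes x: "x \<in> dom_ch c"
  shows "pd c a (\<lambda>y. K y $ b) x = - 2 * \<theta> a x * K x $ b
    + (\<Sum>e\<in>UNIV. christoffel c g e a b x * K x $ e)
    + (\<Sum>e\<in>UNIV. G x $ b $ e * nabla_vec c g a k x $ e)"
proof -
  let ?\<Gamma> = "\<lambda>e a b. christoffel c g e a b x" and ?g = "g c x"
  have dg: "diff_ch c x (\<lambda>y. g c y $ b $ e)" for e
    by (rule diff_ch_bounded_linear[OF bounded_linear_entry diff_g[OF x]])
  have dgk: "diff_ch c x (\<lambda>y. g c y $ b $ e * k y $ e)" for e
    using dg[of e] diff_k[OF x, of e] by (simp add: o_def)
  have d\<phi>gk: "diff_ch c x (\<lambda>y. \<phi> y * (g c y $ b $ e * k y $ e))" for e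
    using pd_\<phi>(2)[OF x] dgk[of e] by (simp add: o_def)
  have "pd c a (\<lambda>y. K y $ b) x = (\<Sum>e\<in>UNIV. pd c a (\<lambda>y. \<phi> y * (g c y $ b $ e * k y $ e)) x)"
    unfolding K_component by (rule pd_sum) (rule d\<phi>gk)
  also have "\<dots> = (\<Sum>e\<in>UNIV. - 2 * \<theta> a x * (\<phi> x * (?g $ b $ e * k x $ e))
      + \<phi> x * ((\<Sum>f\<in>UNIV. ?\<Gamma> f a b * ?g $ f $ e) * k x $ e)
      + \<phi> x * ((\<Sum>f\<in>UNIV. ?\<Gamma> f a e * ?g $ b $ f) * k x $ e)
      + \<phi> x * (?g $ b $ e * pd c a (\<lambda>y. k y $ e) x))"
    unfolding pd_mult[OF atlas chart x pd_\<phi>(2)[OF x] dgk] pd_mult[OF atlas chart x dg diff_k[OF x]]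
      pd_\<phi>(1)[OF x] pd_g[OF x]
    by (intro sum.cong refl) (simp add: algebra_simps)
  also have "\<dots> = - 2 * \<theta> a x * K x $ b
      + (\<Sum>e\<in>UNIV. \<phi> x * ((\<Sum>f\<in>UNIV. ?\<Gamma> f a b * ?g $ f $ e) * k x $ e))
      + (\<Sum>e\<in>UNIV. \<phi> x * ((\<Sum>f\<in>UNIV. ?\<Gamma> f a e * ?g $ b $ f) * k x $ e))
      + (\<Sum>e\<in>UNIV. \<phi> x * (?g $ b $ e * pd c a (\<lambda>y. k y $ e) x))"
    unfolding K_component by (simp only: sum.distrib sum_distrib_left)
  also have "(\<Sum>e\<in>UNIV. \<phi> x * ((\<Sum>f\<in>UNIV. ?\<Gamma> f a b * ?g $ f $ e) * k x $ e))
      = (\<Sum>f\<in>UNIV. ?\<Gamma> f a b * K x $ f)"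
    unfolding K_component sum_distrib_left sum_distrib_right
    by (subst sum.swap) (simp only: mult_ac)
  also have "(\<Sum>e\<in>UNIV. \<phi> x * ((\<Sum>f\<in>UNIV. ?\<Gamma> f a e * ?g $ b $ f) * k x $ e))
      = (\<Sum>f\<in>UNIV. G x $ b $ f * (\<Sum>e\<in>UNIV. ?\<Gamma> f a e * k x $ e))"
    unfolding G_eq sum_distrib_left sum_distrib_right
    by (subst sum.swap) (simp add: mult_ac)
  finally show ?thesis
    by (simp add: nabla_vec_def G_eq distrib_left sum.distrib mult.assoc)
qed

text \<open>Parallelism gives \<open>S (\<nabla>\<^sub>a X) = \<nabla>\<^sub>a (S X)\<close> with
  \<open>S X = (0, - K, r)\<close>; all terms with \<open>\<theta>\<close> cancel.\<close>

lemma S_row_components: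
  assumes x: "x \<in> dom_ch c"
  shows "fst (snd (S x (0, G x $ a, 0))) $ b
    = r x * G x $ a $ b - (\<Sum>e\<in>UNIV. G x $ b $ e * nabla_vec c g a k x $ e)"
    and "snd (snd (S x (0, G x $ a, 0))) = pd c a r x + schouten c g x $ a \<bullet> k x"
proof -
  let ?X = "(0, 0, 1) :: 'n tractor" and ?W = "(0, G x $ a, 0) :: 'n tractor"
  have "pd c a (\<lambda>y. S y ?X) x = S x ?W - \<theta> a x *\<^sub>R S x ?X - conn a x (S x ?X)"
    unfolding pd_S[OF x] conn_top linear_diff[OF linear_S[OF x]] linear_cmul[OF linear_S[OF x]] ..
  then have W: "S x ?W = pd c a (\<lambda>y. S y ?X) x + \<theta> a x *\<^sub>R (0, - K x, r x) + conn a x (0, - K x, r x)"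
    by (simp only: S_top[OF x] algebra_simps)
  have "fst (snd (pd c a (\<lambda>y. S y ?X) x)) $ b = pd c a (\<lambda>y. fst (snd (S y ?X)) $ b) x"
    by (rule pd_bounded_linear[OF bounded_linear_component diff_S[OF x], symmetric])
  \<comment> \<open>The slot is \<open>- K\<close>; the double negation lets linearity pull out a
    sign before \<open>K\<close> is substituted.\<close>
  also have "\<dots> = pd c a (\<lambda>y. - (- (fst (snd (S y ?X)) $ b))) x" by simp
  also have "\<dots> = - pd c a (\<lambda>y. - (fst (snd (S y ?X)) $ b)) x"
    by (rule pd_bounded_linear[OF bounded_linear_minus[OF bounded_linear_ident]
          diff_ch_bounded_linear[OF bounded_linear_minus[OF bounded_linear_component] diff_S[OF x]]])
  also have "pd c a (\<lambda>y. - (fst (snd (S y ?X)) $ b)) x = pd c a (\<lambda>y. K y $ b) x"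
    by (rule pd_cong[OF atlas chart x]) (simp add: S_top)
  finally have "fst (snd (pd c a (\<lambda>y. S y ?X) x)) $ b = - pd c a (\<lambda>y. K y $ b) x" .
  then show "fst (snd (S x ?W)) $ b
    = r x * G x $ a $ b - (\<Sum>e\<in>UNIV. G x $ b $ e * nabla_vec c g a k x $ e)"
    unfolding W pd_K[OF x] by (simp add: conn_def sum_negf)
  have "snd (snd (pd c a (\<lambda>y. S y ?X) x)) = pd c a r x"
    using pd_bounded_linear[OF bounded_linear_snd_snd diff_S[OF x]] unfolding r_def[abs_def] by metis
  then show "snd (snd (S x ?W)) = pd c a r x + schouten c g x $ a \<bullet> k x"
    unfolding W by (simp add: conn_def K_def matrix_vector_mult_uminus Gi_G_vec x)
qed

text \<open>Traces the skew form \<open>h (s W\<^sub>a) W\<^sub>b\<close>, where \<open>W\<^sub>a = (0, G\<^sub>a, 0)\<close>, with the inverse of the conformal metric.\<close>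

lemma r_eq_divergence:
  assumes x: "x \<in> dom_ch c"
  shows "real CARD('n) * r x = divergence c g k x"
proof -
  define F where "F a b = fst (snd (S x (0, G x $ a, 0))) $ b" for a b
  have skew: "F a b = - F b a" for a b
    using skew_S[OF x, of "(0, G x $ a, 0)" "(0, G x $ b, 0)"]
      tm_sym[OF x, of "(0, G x $ a, 0)"] by (simp add: F_def tm_row x)
  have Gis: "Gi x $ a $ b = Gi x $ b $ a" for a b
    using arg_cong[OF Gi_transpose[OF x], of "\<lambda>M. M $ b $ a"] by (simp add: transpose_def)
  \<comment> \<open>Exchanging the indices shows that the contraction of the symmetric
    \<open>Gi\<close> with the skew \<open>F\<close> is its own negative.\<close>
  have "(\<Sum>a\<in>UNIV. \<Sum>b\<in>UNIV. Gi x $ a $ b * F a b) = (\<Sum>a\<in>UNIV. \<Sum>b\<in>UNIV. Gi x $ b $ a * F b a)"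
    by (rule sum.swap)
  also have "\<dots> = - (\<Sum>a\<in>UNIV. \<Sum>b\<in>UNIV. Gi x $ a $ b * F a b)"
    unfolding sum_negf[symmetric]
    by (intro sum.cong refl) (metis Gis skew mult_minus_right)
  finally have "(\<Sum>a\<in>UNIV. \<Sum>b\<in>UNIV. Gi x $ a $ b * F a b) = 0" by simp
  \<comment> \<open>Only \<open>b\<close> is contracted here; summing over \<open>a\<close> then
    gives \<open>n r\<close> minus the divergence.\<close>
  moreover have "(\<Sum>b\<in>UNIV. Gi x $ a $ b * F a b) = r x - nabla_vec c g a k x $ a" for a
  proof -
    have "(Gi x ** G x) $ a $ e = (if a = e then 1 else 0)" for e
      by (simp add: G_Gi x mat_def)
    then have GiG: "(\<Sum>b\<in>UNIV. Gi x $ a $ b * G x $ b $ e) = (if a = e then 1 else 0)" for e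
      by (simp add: matrix_matrix_mult_def)
    have "(\<Sum>b\<in>UNIV. Gi x $ a $ b * F a b) = r x * (\<Sum>b\<in>UNIV. Gi x $ a $ b * G x $ b $ a)
        - (\<Sum>b\<in>UNIV. \<Sum>e\<in>UNIV. Gi x $ a $ b * G x $ b $ e * nabla_vec c g a k x $ e)"
      by (simp add: F_def S_row_components x right_diff_distrib sum_subtractf sum_distrib_left
          G_sym[OF x, of a] mult_ac)
    also have "(\<Sum>b\<in>UNIV. \<Sum>e\<in>UNIV. Gi x $ a $ b * G x $ b $ e * nabla_vec c g a k x $ e)
        = (\<Sum>e\<in>UNIV. (\<Sum>b\<in>UNIV. Gi x $ a $ b * G x $ b $ e) * nabla_vec c g a k x $ e)"
      by (subst sum.swap) (simp only: sum_distrib_right)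
    also have "\<dots> = (\<Sum>e\<in>UNIV. if a = e then nabla_vec c g a k x $ e else 0)"
      by (intro sum.cong refl) (simp add: GiG)
    finally show ?thesis by (simp add: GiG)
  qed
  ultimately show ?thesis by (simp add: sum_subtractf divergence_def)
qed

text \<open>Apply \<open>S\<close> to \<open>S X = r X - k\<^sup>a W_a\<close>. The bottom slot
  gives \<open>lam\<close> as \<open>r\<^sup>2\<close> minus the contraction of \<open>k\<close>
  with the bottom slots of \<open>S W_a\<close>, and \<open>n r\<close> is the divergence.\<close>

lemma lam_formula:
  assumes x: "x \<in> dom_ch c"
  shows "1 / (real CARD('n))\<^sup>2 * (divergence c g k x)\<^sup>2 - k x \<bullet> (schouten c g x *v k x)
    - 1 / real CARD('n) * (\<Sum>a\<in>UNIV. k x $ a * pd c a (divergence c g k) x) = lam x"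
proof -
  let ?n = "real CARD('n)"
  have pdr: "pd c a (divergence c g k) x = ?n * pd c a r x" for a
  proof -
    have "pd c a (divergence c g k) x = pd c a (\<lambda>y. ?n * r y) x"
      by (rule pd_cong[OF atlas chart x]) (simp add: r_eq_divergence)
    also have "\<dots> = ?n * pd c a r x"
      using diff_ch_bounded_linear[OF bounded_linear_snd_snd diff_S[OF x, of "(0, 0, 1)"]]
      unfolding r_def[abs_def] by (rule pd_bounded_linear[OF bounded_linear_mult_right])
    finally show ?thesis .
  qed
  have "(0, - K x, r x) = r x *\<^sub>R (0, 0, 1) - (\<Sum>a\<in>UNIV. k x $ a *\<^sub>R (0, G x $ a, 0) :: 'n tractor)"
  proof -
    have "fst (\<Sum>a\<in>UNIV. k x $ a *\<^sub>R (0, G x $ a, 0) :: 'n tractor) = 0"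
      "fst (snd (\<Sum>a\<in>UNIV. k x $ a *\<^sub>R (0, G x $ a, 0) :: 'n tractor)) = K x"
      "snd (snd (\<Sum>a\<in>UNIV. k x $ a *\<^sub>R (0, G x $ a, 0) :: 'n tractor)) = 0"
      by (simp_all add: fst_sum snd_sum vec_eq_iff K_def matrix_vector_mult_def mult.commute G_sym[OF x])
    then show ?thesis by (simp add: prod_eq_iff)
  qed
  then have "S x (0, - K x, r x) = r x *\<^sub>R S x (0, 0, 1) - (\<Sum>a\<in>UNIV. k x $ a *\<^sub>R S x (0, G x $ a, 0))"
    by (simp only: linear_diff[OF linear_S[OF x]] linear_cmul[OF linear_S[OF x]] linear_sum[OF linear_S[OF x]])
  then have "lam x = (r x)\<^sup>2 - (\<Sum>a\<in>UNIV. k x $ a * (pd c a r x + schouten c g x $ a \<bullet> k x))"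
    by (simp add: lam_def S_top x snd_sum S_row_components power2_eq_square)
  also have "\<dots> = (r x)\<^sup>2 - (\<Sum>a\<in>UNIV. k x $ a * pd c a r x) - k x \<bullet> (schouten c g x *v k x)"
    by (simp add: distrib_left sum.distrib inner_vec_def matrix_vector_mult_def)
  finally show ?thesis
    by (simp add: pdr r_eq_divergence[OF x, symmetric] power_mult_distrib sum_distrib_left mult.left_commute)
qed

end

section \<open>Independence of chart and scale\<close>

text \<open>These tractors form the canonical line \<open>\<T>\<^sup>1\<close>, whose components
  agree in all scales, so eigenvalues can be compared on it.\<close>

lemma scale_change_top: "scale_change c g f x (0, 0, \<rho>) = (0, 0, \<rho>)"
  by (simp add: scale_change_def Let_def)

lemma linear_chart_change: "linear (chart_change c d x)"
  by (rule linearI)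
     (auto simp: chart_change_def algebra_simps simp del: transpose_matrix_vector)

text \<open>Taking determinants in the transformation law of the metric makes
  \<open>det (jac c d x)\<close> a factor of a nonzero number.\<close>

lemma pseudo_metric_det_jac_nz:
  assumes "pseudo_metric A p q g" "c \<in> A" "d \<in> A" "x \<in> dom_ch c" "x \<in> dom_ch d"
  shows "det (jac c d x) \<noteq> 0"
proof -
  have "g c x = transpose (jac c d x) ** g d x ** jac c d x" "invertible (g c x)"
    using assms unfolding pseudo_metric_def by blast+
  then show ?thesis by (auto simp: invertible_det_nz det_mul)
qed

theorem mainTheorem2:
  fixes A :: "('m::{t2_space, second_countable_topology}, 'n::finite) chart set"
    and C :: "('m, 'n) metric_field set"
    and s :: "('m, 'n) tractor_endo"
    and k :: "('m, 'n) chart \<Rightarrow> 'm \<Rightarrow> real^'n"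
    and p q :: nat
  assumes "smooth_atlas A"
    and "connected (UNIV :: 'm set)"
    and "CARD('n) \<ge> 3"
    and "conformal_class A p q C"
    and "adjoint_tractor_field A C s"
    and "parallel_adjoint A C s"
    and "underlying_field A C s k"
    and "isotropic_field A C k"
  shows "\<exists>lam::real.
    (\<forall>g\<in>C. \<forall>c\<in>A. \<forall>x\<in>dom_ch c.
       1 / (real CARD('n))\<^sup>2 * (divergence c g (k c) x)\<^sup>2
       - k c x \<bullet> (schouten c g x *v k c x)
       - 1 / real CARD('n) * (\<Sum>a\<in>UNIV. k c x $ a * pd c a (divergence c g (k c)) x) = lam) \<and>
    (\<forall>g\<in>C. \<forall>c\<in>A. \<forall>x\<in>dom_ch c. s c g x \<circ> s c g x = (\<lambda>v. lam *\<^sub>R v))"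
proof -
  obtain g0 where g0: "pseudo_metric A p q g0"
    and C: "C = {h. pseudo_metric A p q h \<and> (\<exists>f. rescaling A g0 h f)}"
    using assms(4) unfolding conformal_class_def by blast
  \<comment> \<open>The choice \<open>f = 0\<close> puts \<open>g0\<close> in its own class; it
    serves as the reference metric below.\<close>
  have "rescaling A g0 g0 (\<lambda>_. 0)" by (simp add: rescaling_def smooth_in_const)
  then have g0C: "g0 \<in> C" using g0 C by blast

  have loc: "adjoint_tractor_in_scale A c g p q (s c g) (k c)" if "g \<in> C" "c \<in> A" for g c
  proof (rule adjoint_tractor_in_scale.intro)
    show "smooth_atlas A" "c \<in> A" by fact+
    show "pseudo_metric A p q g" using that C by blast
    show "smooth_in c (\<lambda>x. s c g x v)" for v
      using assms(5) that unfolding adjoint_tractor_field_def by blast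
    show "linear (s c g x)" if "x \<in> dom_ch c" for x
      using assms(5) that \<open>g \<in> C\<close> \<open>c \<in> A\<close> unfolding adjoint_tractor_field_def by blast
    show "tractor_metric c g x (s c g x v) w + tractor_metric c g x v (s c g x w) = 0"
      if "x \<in> dom_ch c" for x v w
      using assms(5) that \<open>g \<in> C\<close> \<open>c \<in> A\<close> unfolding adjoint_tractor_field_def by blast
    show "nabla_adjoint c g a (s c g) t x = 0" if "smooth_in c t" "x \<in> dom_ch c" for t x a
      using assms(6) that \<open>g \<in> C\<close> \<open>c \<in> A\<close> unfolding parallel_adjoint_def by blast
    show "smooth_in c (k c)"
      using assms(7) that unfolding underlying_field_def vector_field_def by blast
    show "\<exists>r. s c g x (0, 0, \<rho>) = (0, (- \<rho>) *\<^sub>R (conf_metric c g x *v k c x), r)"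
      if "x \<in> dom_ch c" for x \<rho>
      using assms(7) that \<open>g \<in> C\<close> \<open>c \<in> A\<close> unfolding underlying_field_def by blast
    show "k c x \<bullet> (conf_metric c g x *v k c x) = 0" if "x \<in> dom_ch c" for x
      using assms(8) that \<open>g \<in> C\<close> \<open>c \<in> A\<close> unfolding isotropic_field_def by blast
  qed
  let ?L = "\<lambda>c g. adjoint_tractor_in_scale.lam (s c g)"
  note square = adjoint_tractor_in_scale.SS_eq[OF loc]

  \<comment> \<open>The change of scale intertwines the two endomorphisms and fixes
    \<open>X\<close>, so both have the same eigenvalue on it.\<close>
  have metric_indep: "?L c g x = ?L c g0 x" if g: "g \<in> C" and c: "c \<in> A" and x: "x \<in> dom_ch c" for g c x
  proof -
    let ?X = "(0, 0, 1) :: 'n tractor"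
    obtain f where "rescaling A g0 g f" using g C by blast
    then have sc: "s c g x (scale_change c g0 f x v) = scale_change c g0 f x (s c g0 x v)" for v
      using assms(5) g0C g c x unfolding adjoint_tractor_field_def by blast
    have "s c g x (s c g x ?X) = scale_change c g0 f x (s c g0 x (s c g0 x ?X))"
      using sc[of ?X] sc[of "s c g0 x ?X"] by (simp add: scale_change_top)
    then show ?thesis
      by (simp add: square g g0C c x scale_change_top)
  qed
  have chart_indep: "?L c g0 x = ?L d g0 x"
    if c: "c \<in> A" "x \<in> dom_ch c" and d: "d \<in> A" "x \<in> dom_ch d" for c d x
  proof -
    let ?X = "(0, 0, 1) :: 'n tractor"
    let ?T = "chart_change c d x"
    have ch: "s d g0 x (?T v) = ?T (s c g0 x v)" for v
      using assms(5) g0C c d unfolding adjoint_tractor_field_def by blast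
    have "?L d g0 x *\<^sub>R ?T ?X = s d g0 x (s d g0 x (?T ?X))"
      by (rule square[symmetric]) (use g0C d in auto)
    also have "\<dots> = ?T (s c g0 x (s c g0 x ?X))" by (simp only: ch)
    also have "\<dots> = ?T (?L c g0 x *\<^sub>R ?X)" by (simp only: square[OF g0C c])
    also have "\<dots> = ?L c g0 x *\<^sub>R ?T ?X" by (rule linear_cmul[OF linear_chart_change])
    finally have "?L d g0 x *\<^sub>R ?T ?X = ?L c g0 x *\<^sub>R ?T ?X" .
    \<comment> \<open>Since \<open>0 powr _ = 0\<close>, the weight factor is nonzero only because
      the Jacobian determinant is.\<close>
    moreover have "?T ?X \<noteq> 0"
      using pseudo_metric_det_jac_nz[OF g0 c(1) d(1) c(2) d(2)]
      by (simp add: chart_change_def wt_def zero_prod_def)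
    ultimately show ?thesis by (metis scaleR_cancel_right)
  qed

  have "\<forall>x. \<exists>c. c \<in> A \<and> x \<in> dom_ch c"
    using assms(1) unfolding smooth_atlas_def by blast
  \<comment> \<open>A chart chosen at each point glues the local eigenvalues into one function
    \<open>F\<close>; \<open>chart_indep\<close> makes the choice immaterial.\<close>
  from choice[OF this] obtain ch where ch: "ch x \<in> A \<and> x \<in> dom_ch (ch x)" for x by blast
  define F where "F x = ?L (ch x) g0 x" for x
  have F: "?L c g x = F x" if "g \<in> C" "c \<in> A" "x \<in> dom_ch c" for g c x
    unfolding F_def metric_indep[OF that] using that ch by (intro chart_indep) auto
  have "\<exists>T. openin (top_of_set UNIV) T \<and> x \<in> T \<and> (\<forall>y\<in>T. F y = F x)" for x
  proof -
    have c: "ch x \<in> A" "x \<in> dom_ch (ch x)" using ch by auto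
    note l = loc[OF g0C c(1)]
    obtain T where T: "open T" "x \<in> T" "T \<subseteq> dom_ch (ch x)"
        "\<And>y. y \<in> T \<Longrightarrow> ?L (ch x) g0 y = ?L (ch x) g0 x"
      using pd_zero_imp_locally_constant[OF assms(1) c adjoint_tractor_in_scale.diff_lam[OF l]
          adjoint_tractor_in_scale.pd_lam_eq_0[OF l]] by blast
    have "F y = F x" if "y \<in> T" for y
      using T(4)[OF that] F[OF g0C c(1), of y] F[OF g0C c(1), of x] subsetD[OF T(3) that] subsetD[OF T(3) T(2)] by simp
    moreover have "openin (top_of_set UNIV) T" using T(1) by simp
    ultimately show ?thesis using T(2) by blast
  qed
  \<comment> \<open>Connectedness of the manifold enters here: it turns the locally constant
    \<open>F\<close> into a constant.\<close>
  then have "F constant_on UNIV"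
    by (intro locally_constant_imp_constant[OF assms(2)]) blast
  then obtain lam where lam: "F x = lam" for x
    unfolding constant_on_def by blast
  show ?thesis
  proof (intro exI[of _ lam] conjI ballI)
    fix g c x
    assume *: "g \<in> C" "c \<in> A" "x \<in> dom_ch c"
    show "1 / (real CARD('n))\<^sup>2 * (divergence c g (k c) x)\<^sup>2
       - k c x \<bullet> (schouten c g x *v k c x)
       - 1 / real CARD('n) * (\<Sum>a\<in>UNIV. k c x $ a * pd c a (divergence c g (k c)) x) = lam"
      using adjoint_tractor_in_scale.lam_formula[OF loc[OF *(1,2)] *(3)] F[OF *] lam by simp
    show "s c g x \<circ> s c g x = (\<lambda>v. lam *\<^sub>R v)"
      using square[OF *] F[OF *] lam by (auto simp: fun_eq_iff)
  qed
qed
end
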